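(* Let $Q$ be a join query over variables $X=\{x_1,\dots,x_n\}$ and finite domain $D$. Given a $Q$-estimator $\mathsf{q\_upb}$ such that $\mathsf{q\_upb}(\tau)$ can be evaluated in time $t$ for every $\tau$, it is possible to uniformly sample $\mathsf{ans}(Q)$ with expected time $$\mathcal{O}\left(\frac{\mathsf{q\_upb}(\langle\rangle)}{\max(1,|\mathsf{ans}(Q)|)}\cdot|X|\cdot|D|\cdot t\right).$$
   Context: **Join queries.** For finite sets $X$ (variables) and $D$ (domain), $D^X$ is the set of maps (tuples) $X\to D$; $\langle\rangle$ is the empty tuple; $\tau\cup\langle x\gets d\rangle$ extends $\tau$ by mapping the new variable $x$ to $d$. For $\tau\in D^Y$, $\tau_{|Z}$ is the restriction of $\tau$ to $Y\cap Z$. A relation $R$ is a finite subset of $D^{X_R}$. For $\tau\in D^Y$, $R[\tau]=\{\sigma_{|X_R\setminus Y}:\sigma\in R,\ \sigma_{|Y}=\tau_{|X_R}\}$. A join query $Q$ over $X$ and $D$ is a finite set of relations $R\subseteq D^{X_R}$ with $X_R\subseteq X$. Its answer set is $\mathsf{ans}(Q)=\{\tau\in D^X:\tau_{|X_R}\in R\text{ for all }R\in Q\}$. A tuple $\tau$ is inconsistent with $Q$ if $R[\tau]=\emptyset$ for some $R\in Q$, and consistent with $Q$ otherwise. **Trace tree.** Fix the order $(x_1,\dots,x_n)$ and let $X_i=\{x_1,\dots,x_i\}$ for $0\le i\le n$. The trace tree $T_Q$ is the rooted tree with root $\langle\rangle$ whose nodes are the tuples $\tau\in D^{X_i}$ ($0\le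 i\le n$) that are consistent with $Q$, or are inconsistent with $Q$ but have a parent that is consistent with $Q$; the parent of $\tau\cup\langle x_{i+1}\gets d\rangle$ is $\tau\in D^{X_i}$. **$Q$-estimator.** A nonnegative real-valued function $\mathsf{q\_upb}$ on the nodes of $T_Q$ such that: (1) for every node $\tau\in D^{X_i}$ with $i<n$ that is consistent with $Q$, $\mathsf{q\_upb}(\tau)\ge\sum_{d\in D}\mathsf{q\_upb}(\tau\cup\langle x_{i+1}\gets d\rangle)$; (2) $\mathsf{q\_upb}(\tau)=1$ when $\tau\in\mathsf{ans}(Q)$; (3) $\mathsf{q\_upb}(\tau)=0$ when $\tau$ is inconsistent with $Q$. **Sampling.** Uniformly sampling a finite set $S$ means outputting each element of $S$ with probability $1/|S|$ if $S\ne\emptyset$, and answering that $S$ is empty otherwise.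
   Formalization: The factor multiplying t in the O-bound is replaced by its maximum with 1, since the stated bound can be 0 or arbitrarily small (for instance X or D empty, or no answers and q_upb(⟨⟩) = 0), while any algorithm takes at least one step. *)

theory Defs
  imports "HOL-Probability.Probability"
begin

section \<open>Join queries\<close>

text \<open>
  Tuples over a set of variables \<open>Y\<close> are partial maps with domain exactly \<open>Y\<close>; the empty tuple
  is \<^const>\<open>Map.empty\<close>, extension is map update, and the restriction to \<open>Y \<inter> Z\<close> is \<open>\<tau> |` Z\<close>.
  A relation carries its variable set explicitly, since it cannot be recovered from an empty set
  of tuples.
\<close>

type_synonym ('x, 'd) tuple = "'x \<rightharpoonup> 'd"
type_synonym ('x, 'd) relation = "'x set \<times> ('x, 'd) tuple set"

definition tuples :: "'x set \<Rightarrow> 'd set \<Rightarrow> ('x, 'd) tuple set" where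
  "tuples Y D = {\<tau>. dom \<tau> = Y \<and> ran \<tau> \<subseteq> D}"

definition join_query :: "'x set \<Rightarrow> 'd set \<Rightarrow> ('x, 'd) relation set \<Rightarrow> bool" where
  "join_query X D Q \<longleftrightarrow> finite Q \<and> (\<forall>(XR, R) \<in> Q. XR \<subseteq> X \<and> R \<subseteq> tuples XR D \<and> finite R)"

definition ans :: "'x set \<Rightarrow> 'd set \<Rightarrow> ('x, 'd) relation set \<Rightarrow> ('x, 'd) tuple set" where
  "ans X D Q = {\<tau> \<in> tuples X D. \<forall>(XR, R) \<in> Q. \<tau> |` XR \<in> R}"

definition section_of :: "('x, 'd) relation \<Rightarrow> ('x, 'd) tuple \<Rightarrow> ('x, 'd) tuple set" where
  "section_of = (\<lambda>(XR, R) \<tau>. {\<sigma> |` (XR - dom \<tau>) | \<sigma>. \<sigma> \<in> R \<and> \<sigma> |` dom \<tau> = \<tau> |` XR})"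

definition consistent :: "('x, 'd) relation set \<Rightarrow> ('x, 'd) tuple \<Rightarrow> bool" where
  "consistent Q \<tau> \<longleftrightarrow> \<not> (\<exists>R \<in> Q. section_of R \<tau> = {})"


section \<open>Trace tree and estimators\<close>

text \<open>
  The list \<open>xs\<close> is the variable order \<open>(x\<^sub>1, \<dots>, x\<^sub>n)\<close>, so \<open>X\<^sub>i = set (take i xs)\<close> and
  \<open>x\<^bsub>i+1\<^esub> = xs ! i\<close>. The root is a node even if it is itself inconsistent.
\<close>

definition trace_nodes ::
    "'x list \<Rightarrow> 'd set \<Rightarrow> ('x, 'd) relation set \<Rightarrow> ('x, 'd) tuple set" where
  "trace_nodes xs D Q =
     {Map.empty}
     \<union> {\<tau>. \<exists>i \<le> length xs. \<tau> \<in> tuples (set (take i xs)) D \<and> consistent Q \<tau>}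
     \<union> {\<tau>(xs ! i \<mapsto> d) | \<tau> i d.
          i < length xs \<and> \<tau> \<in> tuples (set (take i xs)) D \<and> consistent Q \<tau> \<and> d \<in> D}"

definition estimator ::
    "'x list \<Rightarrow> 'd set \<Rightarrow> ('x, 'd) relation set \<Rightarrow> (('x, 'd) tuple \<Rightarrow> real) \<Rightarrow> bool" where
  "estimator xs D Q q \<longleftrightarrow>
     (\<forall>\<tau> \<in> trace_nodes xs D Q. q \<tau> \<ge> 0) \<and>
     (\<forall>i < length xs. \<forall>\<tau> \<in> tuples (set (take i xs)) D.
        consistent Q \<tau> \<longrightarrow> q \<tau> \<ge> (\<Sum>d\<in>D. q (\<tau>(xs ! i \<mapsto> d)))) \<and>
     (\<forall>\<tau> \<in> ans (set xs) D Q. q \<tau> = 1) \<and>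
     (\<forall>\<tau> \<in> trace_nodes xs D Q. \<not> consistent Q \<tau> \<longrightarrow> q \<tau> = 0)"


section \<open>Randomized real-RAM programs\<close>

text \<open>
  A program works on finitely many registers for natural numbers, finitely many registers for
  exact real numbers, and an indirectly addressable memory of natural numbers. Each executed
  command and each guard test takes one unit of time. Expressions occurring in one fixed program
  have bounded size, so charging their evaluation as one unit only affects constant factors.
  There is no multiplication of naturals and no rounding of reals.

  \<open>Query i e\<close> evaluates an external function at the word stored in the first \<open>e\<close> memory cells and
  puts the value into real register \<open>i\<close>; it additionally costs the time of that evaluation.
  \<open>Flip i e\<close> puts \<open>1\<close> into register \<open>i\<close> with probability \<open>e\<close> (clipped to the unit interval by
  \<^const>\<open>bernoulli_pmf\<close>) and \<open>0\<close> otherwise.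
\<close>

datatype nexp =
  NConst nat | NReg nat | NCell nexp | NPlus nexp nexp | NMinus nexp nexp

datatype rexp =
  RConst nat | RReg nat | RPlus rexp rexp | RMinus rexp rexp | RTimes rexp rexp | RDivide rexp rexp

datatype bexp =
  NLess nexp nexp | RLess rexp rexp | BNot bexp | BAnd bexp bexp

datatype com =
  Skip | NAssign nat nexp | Store nexp nexp | RAssign nat rexp | Query nat nexp | Flip nat rexp
| Seq com com | If bexp com com | While bexp com

record state =
  nreg :: "nat \<Rightarrow> nat"
  rreg :: "nat \<Rightarrow> real"
  cell :: "nat \<Rightarrow> nat"
  clock :: nat

primrec nval :: "nexp \<Rightarrow> state \<Rightarrow> nat" where
  "nval (NConst k) s = k"
| "nval (NReg i) s = nreg s i"
| "nval (NCell e) s = cell s (nval e s)"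
| "nval (NPlus e f) s = nval e s + nval f s"
| "nval (NMinus e f) s = nval e s - nval f s"

primrec rval :: "rexp \<Rightarrow> state \<Rightarrow> real" where
  "rval (RConst k) s = real k"
| "rval (RReg i) s = rreg s i"
| "rval (RPlus e f) s = rval e s + rval f s"
| "rval (RMinus e f) s = rval e s - rval f s"
| "rval (RTimes e f) s = rval e s * rval f s"
| "rval (RDivide e f) s = rval e s / rval f s"

primrec bval :: "bexp \<Rightarrow> state \<Rightarrow> bool" where
  "bval (NLess e f) s \<longleftrightarrow> nval e s < nval f s"
| "bval (RLess e f) s \<longleftrightarrow> rval e s < rval f s"
| "bval (BNot b) s \<longleftrightarrow> \<not> bval b s"
| "bval (BAnd b c) s \<longleftrightarrow> bval b s \<and> bval c s"

definition tick :: "nat \<Rightarrow> state \<Rightarrow> state" where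
  "tick k s = s\<lparr>clock := clock s + k\<rparr>"

definition word_at :: "nat \<Rightarrow> state \<Rightarrow> nat list" where
  "word_at k s = map (cell s) [0..<k]"

text \<open>Least fixed point; the missing mass is the probability of divergence.\<close>

partial_function (spmf) while_spmf :: "('s \<Rightarrow> bool) \<Rightarrow> ('s \<Rightarrow> 's spmf) \<Rightarrow> 's \<Rightarrow> 's spmf" where
  "while_spmf g f s = (if g s then bind_spmf (f s) (while_spmf g f) else return_spmf s)"

primrec exec :: "(nat list \<Rightarrow> real) \<Rightarrow> (nat list \<Rightarrow> nat) \<Rightarrow> com \<Rightarrow> state \<Rightarrow> state spmf" where
  "exec f c Skip s = return_spmf (tick 1 s)"
| "exec f c (NAssign i e) s = return_spmf (tick 1 (s\<lparr>nreg := (nreg s)(i := nval e s)\<rparr>))"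
| "exec f c (Store a e) s = return_spmf (tick 1 (s\<lparr>cell := (cell s)(nval a s := nval e s)\<rparr>))"
| "exec f c (RAssign i e) s = return_spmf (tick 1 (s\<lparr>rreg := (rreg s)(i := rval e s)\<rparr>))"
| "exec f c (Query i e) s =
     (let w = word_at (nval e s) s
      in return_spmf (tick (1 + c w) (s\<lparr>rreg := (rreg s)(i := f w)\<rparr>)))"
| "exec f c (Flip i e) s =
     map_spmf (\<lambda>b. tick 1 (s\<lparr>nreg := (nreg s)(i := of_bool b)\<rparr>))
       (spmf_of_pmf (bernoulli_pmf (rval e s)))"
| "exec f c (Seq p p') s = bind_spmf (exec f c p s) (exec f c p')"
| "exec f c (If b p p') s =
     (if bval b s then exec f c p (tick 1 s) else exec f c p' (tick 1 s))"
| "exec f c (While b p) s =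
     map_spmf (tick 1) (while_spmf (bval b) (\<lambda>s. exec f c p (tick 1 s)) s)"


section \<open>Sampling algorithms with access to an estimator\<close>

text \<open>
  The variables are accessed through their position in \<open>xs\<close>, and the domain elements through
  their position in an arbitrary enumeration \<open>ds\<close> of the domain. A word of length \<open>i\<close> over the
  positions of \<open>ds\<close> encodes a tuple over the first \<open>i\<close> variables (\<^const>\<open>zip\<close> truncates).
  A program is given the numbers of variables and of domain elements in registers \<open>0\<close> and \<open>1\<close>;
  the query is accessible only through the estimator \<open>q\<close>, whose evaluation at \<open>\<tau>\<close> takes
  time \<open>cost \<tau>\<close>.
\<close>

definition decode :: "'x list \<Rightarrow> 'd list \<Rightarrow> nat list \<Rightarrow> ('x, 'd) tuple" where
  "decode xs ds w = map_of (zip xs (map ((!) ds) w))"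

definition init_state :: "nat \<Rightarrow> nat \<Rightarrow> state" where
  "init_state n m =
     \<lparr>nreg = (\<lambda>_. 0)(0 := n, 1 := m), rreg = (\<lambda>_. 0), cell = (\<lambda>_. 0), clock = 0\<rparr>"

definition run ::
    "com \<Rightarrow> 'x list \<Rightarrow> 'd list \<Rightarrow> (('x, 'd) tuple \<Rightarrow> real) \<Rightarrow> (('x, 'd) tuple \<Rightarrow> nat) \<Rightarrow> state spmf"
  where
  "run prog xs ds q cost =
     exec (q \<circ> decode xs ds) (cost \<circ> decode xs ds) prog (init_state (length xs) (length ds))"

datatype 'a outcome = Empty | Sample 'a

text \<open>Register \<open>0\<close> finally tells whether a tuple is output, namely the one stored in memory.\<close>

definition outcome :: "'x list \<Rightarrow> 'd list \<Rightarrow> state \<Rightarrow> ('x, 'd) tuple outcome" where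
  "outcome xs ds s =
     (if nreg s 0 = 0 then Empty else Sample (decode xs ds (word_at (length xs) s)))"

text \<open>For finite \<open>S\<close> this fixes the whole distribution, and in particular implies termination
  with probability \<open>1\<close>.\<close>

definition uniformly_samples :: "'a outcome spmf \<Rightarrow> 'a set \<Rightarrow> bool" where
  "uniformly_samples p S \<longleftrightarrow>
     (if S = {} then spmf p Empty = 1 else (\<forall>a\<in>S. spmf p (Sample a) = 1 / real (card S)))"

text \<open>This is the expected running time only for programs that terminate with probability \<open>1\<close>,
  as diverging runs do not contribute.\<close>

definition expected_time :: "state spmf \<Rightarrow> ennreal" where
  "expected_time p = (\<integral>\<^sup>+ s. of_nat (clock s) \<partial>measure_spmf p)"

end

theory Submission
  imports Defs
begin

text \<open>
  Descending from the root and choosing the child \<open>d\<close> of \<open>\<tau>\<close> with probability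
  \<open>q (\<tau> d) / q \<tau>\<close>, and failing with the remaining probability, reaches every answer with
  probability \<open>1 / q \<langle>\<rangle>\<close>; repeating until success thus samples uniformly in an expected number of
  \<open>q \<langle>\<rangle> / |ans|\<close> rounds. To recognise an empty answer set, round \<open>k = 0, 1, 2, \<dots>\<close> is followed by a
  deterministic descent. Nest the nodes as intervals of length \<open>q \<tau>\<close> inside \<open>{0..<q \<langle>\<rangle>}\<close>, the
  children of a node being placed one after the other; every answer then owns a half-open interval
  of length \<open>1\<close>, hence an integer, and the descent follows the intervals that contain \<open>k\<close>. If none
  of the integers \<open>k < q \<langle>\<rangle>\<close> leads to an answer, there is no answer. Since \<open>q \<langle>\<rangle> < 1\<close> already
  rules out answers, at most \<open>2 q \<langle>\<rangle>\<close> rounds are spent on an empty answer set.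
\<close>

section \<open>Expectations of program runs\<close>

text \<open>Monotone convergence along a chain that need not be a sequence: the limit has countable
  support, and over a countable set the integral commutes with suprema of arbitrary chains.
  Admissibility in fixed point induction rests on it.\<close>

lemma nn_integral_lub_spmf:
  fixes h :: "'a \<Rightarrow> ennreal"
  assumes chain: "Complete_Partial_Order.chain (ord_spmf (=)) Y" and Y: "Y \<noteq> {}"
  shows "(\<integral>\<^sup>+ x. h x \<partial>measure_spmf (lub_spmf Y)) = (SUP p\<in>Y. \<integral>\<^sup>+ x. h x \<partial>measure_spmf p)"
proof -
  let ?M = "count_space (set_spmf (lub_spmf Y))"
  have chain': "Complete_Partial_Order.chain (\<le>) ((\<lambda>p x. ennreal (spmf p x) * h x) ` Y)"
    using chain
    by (rule chain_imageI) (auto simp: le_fun_def dest: ord_spmf_eq_leD intro!: mult_right_mono)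
  have "(\<integral>\<^sup>+ x. h x \<partial>measure_spmf (lub_spmf Y)) = (\<integral>\<^sup>+ x. ennreal (spmf (lub_spmf Y) x) * h x \<partial>?M)"
    by (simp add: nn_integral_measure_spmf')
  also have "\<dots> = (\<integral>\<^sup>+ x. (SUP p\<in>Y. ennreal (spmf p x) * h x) \<partial>?M)"
    by (subst ennreal_spmf_lub_spmf[OF chain Y]) (subst SUP_mult_right_ennreal, simp_all)
  also have "\<dots> = (SUP p\<in>Y. \<integral>\<^sup>+ x. ennreal (spmf p x) * h x \<partial>?M)"
    using Y chain' by (rule nn_integral_monotone_convergence_SUP_countable) simp
  also have "\<dots> = (SUP p\<in>Y. \<integral>\<^sup>+ x. h x \<partial>measure_spmf p)"
    by (auto simp: nn_integral_measure_spmf nn_integral_count_space_indicator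
        set_lub_spmf[OF chain] in_set_spmf_iff_spmf
        intro!: arg_cong [of _ _ Sup] image_cong nn_integral_cong split: split_indicator)
  finally show ?thesis .
qed

lemma nn_integral_bind_spmf:
  fixes h :: "'b \<Rightarrow> ennreal"
  shows "(\<integral>\<^sup>+ x. h x \<partial>measure_spmf (bind_spmf p k))
    = (\<integral>\<^sup>+ y. (\<integral>\<^sup>+ x. h x \<partial>measure_spmf (k y)) \<partial>measure_spmf p)"
  unfolding measure_spmf_bind
  by (subst nn_integral_bind[where B = "count_space UNIV"])
     (auto simp: o_def space_measure_spmf sets_measure_spmf space_subprob_algebra
       intro!: subprob_space_measure_spmf)

lemma nn_integral_return_spmf:
  fixes h :: "'a \<Rightarrow> ennreal"
  shows "(\<integral>\<^sup>+ x. h x \<partial>measure_spmf (return_spmf y)) = h y"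
  by (simp add: measure_spmf_return_spmf nn_integral_return)

text \<open>Park induction: a superinvariant \<open>I\<close> bounds the least fixed point. Only
  upper bounds arise this way, since diverging mass contributes 0; lower bounds are obtained below
  by finite unrolling.\<close>

lemma nn_integral_while_spmf_le:
  fixes h :: "'s \<Rightarrow> ennreal"
  assumes "\<And>s. \<not> b s \<Longrightarrow> h s \<le> I s"
    and "\<And>s. b s \<Longrightarrow> (\<integral>\<^sup>+ x. I x \<partial>measure_spmf (k s)) \<le> I s"
  shows "(\<integral>\<^sup>+ x. h x \<partial>measure_spmf (while_spmf b k s)) \<le> I s"
proof -
  have "\<forall>s. (\<integral>\<^sup>+ x. h x \<partial>measure_spmf (while_spmf b k s)) \<le> I s"
  proof (induction rule: while_spmf.fixp_induct)
    case 1
    show ?case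
    proof (rule ccpo.admissibleI)
      fix A :: "((('s \<Rightarrow> bool) \<times> ('s \<Rightarrow> 's spmf)) \<times> 's \<Rightarrow> 's spmf) set"
      assume chain: "Complete_Partial_Order.chain (fun_ord (ord_spmf (=))) A"
        and "A \<noteq> {}"
        and le: "\<forall>x\<in>A. \<forall>s. (\<integral>\<^sup>+ y. h y \<partial>measure_spmf (curry (curry x) b k s)) \<le> I s"
      show "\<forall>s. (\<integral>\<^sup>+ y. h y \<partial>measure_spmf (curry (curry (fun_lub lub_spmf A)) b k s)) \<le> I s"
        unfolding curry_conv
      proof
        fix s
        let ?Y = "(\<lambda>x. x ((b, k), s)) ` A"
        have lub: "fun_lub lub_spmf A ((b, k), s) = lub_spmf ?Y"
          by (auto simp: fun_lub_def intro!: arg_cong[where f = lub_spmf])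
        have "Complete_Partial_Order.chain (ord_spmf (=)) ?Y"
          using chain by (rule chain_imageI) (simp add: fun_ord_def)
        with le \<open>A \<noteq> {}\<close>
        show "(\<integral>\<^sup>+ y. h y \<partial>measure_spmf (fun_lub lub_spmf A ((b, k), s))) \<le> I s"
          unfolding lub by (subst nn_integral_lub_spmf) (auto intro: SUP_least)
      qed
    qed
  next
    case 2
    show ?case by simp
  next
    case (3 w)
    then have "(\<integral>\<^sup>+ y. \<integral>\<^sup>+ x. h x \<partial>measure_spmf (w b k y) \<partial>measure_spmf (k s)) \<le> I s"
      if "b s" for s
      by (intro order_trans[OF nn_integral_mono assms(2)] that) simp
    then show ?case
      by (auto simp: nn_integral_bind_spmf nn_integral_return_spmf assms(1))
  qed
  then show ?thesis by blast
qed

text \<open>The weakest preexpectation; it treats probabilities and expected clock readings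
  alike.\<close>

definition wp :: "(nat list \<Rightarrow> real) \<Rightarrow> (nat list \<Rightarrow> nat) \<Rightarrow> com \<Rightarrow> (state \<Rightarrow> ennreal) \<Rightarrow> state \<Rightarrow> ennreal" where
  "wp f c p g s = (\<integral>\<^sup>+ x. g x \<partial>measure_spmf (exec f c p s))"

lemma wp_simps [simp]:
  "wp f c Skip g s = g (tick 1 s)"
  "wp f c (NAssign i e) g s = g (tick 1 (s\<lparr>nreg := (nreg s)(i := nval e s)\<rparr>))"
  "wp f c (Store a e) g s = g (tick 1 (s\<lparr>cell := (cell s)(nval a s := nval e s)\<rparr>))"
  "wp f c (RAssign i r) g s = g (tick 1 (s\<lparr>rreg := (rreg s)(i := rval r s)\<rparr>))"
  "wp f c (Query i e) g s =
     g (tick (1 + c (word_at (nval e s) s)) (s\<lparr>rreg := (rreg s)(i := f (word_at (nval e s) s))\<rparr>))"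
  "wp f c (Seq p p') g s = wp f c p (wp f c p' g) s"
  "wp f c (If b p p') g s = (if bval b s then wp f c p g (tick 1 s) else wp f c p' g (tick 1 s))"
  by (simp_all add: wp_def nn_integral_return_spmf Let_def nn_integral_bind_spmf)

lemma wp_Flip:
  assumes "0 \<le> rval e s" "rval e s \<le> 1"
  shows "wp f c (Flip i e) g s =
     ennreal (rval e s) * g (tick 1 (s\<lparr>nreg := (nreg s)(i := 1)\<rparr>))
     + ennreal (1 - rval e s) * g (tick 1 (s\<lparr>nreg := (nreg s)(i := 0)\<rparr>))"
  using assms by (simp add: wp_def mult.commute o_def)

lemma wp_While:
  "wp f c (While b p) g s =
     (if bval b s then wp f c p (wp f c (While b p) g) (tick 1 s) else g (tick 1 s))"
proof -
  let ?w = "while_spmf (bval b) (\<lambda>s. exec f c p (tick 1 s))"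
  have "?w s = (if bval b s then bind_spmf (exec f c p (tick 1 s)) ?w else return_spmf s)"
    by (rule while_spmf.simps)
  then show ?thesis
    by (simp add: wp_def[abs_def] o_def nn_integral_bind_spmf nn_integral_return_spmf)
qed

lemma wp_While_le:
  assumes "\<And>s. \<not> bval b s \<Longrightarrow> g (tick 1 s) \<le> I s"
    and "\<And>s. bval b s \<Longrightarrow> wp f c p I (tick 1 s) \<le> I s"
  shows "wp f c (While b p) g s \<le> I s"
  using assms unfolding wp_def by (simp add: o_def) (rule nn_integral_while_spmf_le)

section \<open>The sampling program\<close>

text \<open>
  Natural registers: \<open>2\<close> and \<open>3\<close> are the depth of the current node and its next child to be tried,
  \<open>4\<close> is the last coin, \<open>5\<close> is \<open>0\<close> during random descents, \<open>6\<close> tells whether a deterministic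
  descent has found an answer, and \<open>7\<close> whether a random one has. Real registers: \<open>0\<close> is the value at the
  root, \<open>1\<close> that of the current node minus those of its children already rejected, \<open>2\<close> the
  target of the deterministic descent relative to the first child not yet rejected, \<open>3\<close> the value
  at the child being tried, \<open>4\<close> the probability of descending to it, and \<open>5\<close> the number of the round.
\<close>

abbreviation seq :: "com \<Rightarrow> com \<Rightarrow> com" (infixr ";;" 60) where
  "p ;; p' \<equiv> Seq p p'"

definition walk_step :: com where
  "walk_step =
     Store (NReg 2) (NReg 3) ;;
     Query 3 (NPlus (NReg 2) (NConst 1)) ;;
     If (NLess (NReg 5) (NConst 1))
       (RAssign 4 (RDivide (RReg 3) (RReg 1)))
       (If (RLess (RReg 2) (RReg 3)) (RAssign 4 (RConst 1)) (RAssign 4 (RConst 0))) ;;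
     Flip 4 (RReg 4) ;;
     If (NLess (NConst 0) (NReg 4))
       (NAssign 2 (NPlus (NReg 2) (NConst 1)) ;; NAssign 3 (NConst 0) ;; RAssign 1 (RReg 3))
       (NAssign 3 (NPlus (NReg 3) (NConst 1)) ;; RAssign 1 (RMinus (RReg 1) (RReg 3)) ;;
        RAssign 2 (RMinus (RReg 2) (RReg 3)))"

definition walk_loop :: com where
  "walk_loop = While (BAnd (NLess (NReg 2) (NReg 0)) (NLess (NReg 3) (NReg 1))) walk_step"

definition walk :: "nat \<Rightarrow> com" where
  "walk mode = NAssign 5 (NConst mode) ;; NAssign 2 (NConst 0) ;; NAssign 3 (NConst 0) ;;
     RAssign 1 (RReg 0) ;; RAssign 2 (RReg 5) ;; walk_loop"

text \<open>The leaf found by the deterministic descent is never output, since this would bias the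
  distribution. It only certifies that an answer exists, after which the round number no longer
  limits the loop.\<close>

definition trial :: com where
  "trial = walk 0 ;;
     If (NLess (NReg 2) (NReg 0))
       (walk 1 ;; If (NLess (NReg 2) (NReg 0)) Skip (NAssign 6 (NConst 1)) ;;
        RAssign 5 (RPlus (RReg 5) (RConst 1)))
       (NAssign 7 (NConst 1))"

definition trials :: com where
  "trials = While (BAnd (NLess (NReg 7) (NConst 1))
     (BNot (BAnd (NLess (NReg 6) (NConst 1)) (BNot (RLess (RReg 5) (RReg 0)))))) trial"

text \<open>Both early exits protect the running time. With variables but an empty domain the
  claimed bound does not grow with the value at the root, whereas the number of rounds would; with a
  value below 1 a single round could already be too expensive.\<close>

definition sampler :: com where
  "sampler = If (BAnd (NLess (NConst 0) (NReg 0)) (NLess (NReg 1) (NConst 1)))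
     (NAssign 0 (NConst 0))
     (Query 0 (NConst 0) ;;
      If (RLess (RReg 0) (RConst 1)) (NAssign 0 (NConst 0)) (trials ;; NAssign 0 (NReg 7)))"

definition frame :: "state \<Rightarrow> state \<Rightarrow> bool" where
  "frame s s' \<longleftrightarrow> (\<forall>k \<in> {0, 1, 5, 6, 7}. nreg s' k = nreg s k) \<and> (\<forall>k \<in> {0, 5}. rreg s' k = rreg s k)"

lemma frame_trans: "frame s s' \<Longrightarrow> frame s' s'' \<Longrightarrow> frame s s''"
  by (auto simp: frame_def)

lemma tick_sel [simp]:
  "nreg (tick k s) = nreg s" "rreg (tick k s) = rreg s" "cell (tick k s) = cell s"
  "clock (tick k s) = clock s + k" "word_at i (tick k s) = word_at i s"
  by (simp_all add: tick_def word_at_def)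

section \<open>Estimators on words of child positions\<close>

text \<open>Words of child positions replace tuples, and \<open>cs\<close> stands for consistency.
  \<open>F\<close> and \<open>c\<close> are constrained only at the root and at children of words
  satisfying \<open>cs\<close>, so the program must not query elsewhere. \<open>F_pos\<close> and
  \<open>F_root\<close> say contrapositively that inconsistent nodes have no weight.\<close>

locale word_estimator =
  fixes n m T :: nat and F :: "nat list \<Rightarrow> real" and c :: "nat list \<Rightarrow> nat"
    and cs :: "nat list \<Rightarrow> bool"
  assumes valid: "cs w \<Longrightarrow> length w \<le> n \<and> set w \<subseteq> {..<m}"
    and cs_prefix: "cs (w @ [d]) \<Longrightarrow> cs w"
    and F_nonneg: "cs w \<Longrightarrow> length w < n \<Longrightarrow> d < m \<Longrightarrow> 0 \<le> F (w @ [d])"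
    and F_superadditive: "cs w \<Longrightarrow> length w < n \<Longrightarrow> (\<Sum>d<m. F (w @ [d])) \<le> F w"
    and F_full: "cs w \<Longrightarrow> length w = n \<Longrightarrow> F w = 1"
    and F_pos: "cs w \<Longrightarrow> length w < n \<Longrightarrow> d < m \<Longrightarrow> 0 < F (w @ [d]) \<Longrightarrow> cs (w @ [d])"
    and F_root: "0 < F [] \<Longrightarrow> cs []"
    and c_child: "cs w \<Longrightarrow> length w < n \<Longrightarrow> d < m \<Longrightarrow> c (w @ [d]) \<le> T"
    and c_root: "c [] \<le> T"
begin

section \<open>Answers and the weight they occupy\<close>

definition answers :: "nat list set" where
  "answers = {a. cs a \<and> length a = n}"

text \<open>The index \<open>j\<close> is ignored at leaves, where it has no meaning.\<close>

definition later :: "nat list \<Rightarrow> nat \<Rightarrow> nat list set" where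
  "later w j = {a \<in> answers. take (length w) a = w \<and> (length w < n \<longrightarrow> j \<le> a ! length w)}"

text \<open>What remains of \<open>F w\<close> once the children before \<open>j\<close> are
  rejected: the content of real register 1 and the denominator of the next random coin.\<close>

definition rest :: "nat list \<Rightarrow> nat \<Rightarrow> real" where
  "rest w j = F w - (\<Sum>d<j. F (w @ [d]))"

lemma finite_answers: "finite answers"
proof (rule finite_subset)
  show "answers \<subseteq> {a. set a \<subseteq> {..<m} \<and> length a = n}"
    using valid by (auto simp: answers_def)
  show "finite {a. set a \<subseteq> {..<m} \<and> length a = n}"
    by (intro finite_lists_length_eq finite_lessThan)
qed

lemma finite_later: "finite (later w j)"
  using finite_answers by (simp add: later_def)

lemma cs_take: "cs a \<Longrightarrow> cs (take k a)"
proof (induction a rule: rev_induct)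
  case (snoc x xs)
  then show ?case using cs_prefix by (cases "k \<le> length xs") auto
qed simp

lemma answer_nth_less: "a \<in> answers \<Longrightarrow> i < n \<Longrightarrow> a ! i < m"
  using valid nth_mem by (fastforce simp: answers_def)

lemma later_leaf: "cs w \<Longrightarrow> length w = n \<Longrightarrow> later w j = {w}"
  by (auto simp: later_def answers_def)

lemma later_last: "length w < n \<Longrightarrow> later w m = {}"
  using answer_nth_less by (fastforce simp: later_def)

lemma later_split:
  assumes "length w < n"
  shows "later w j = later (w @ [j]) 0 \<union> later w (Suc j)"
    and "later (w @ [j]) 0 \<inter> later w (Suc j) = {}"
proof -
  have "take (Suc (length w)) a = w @ [j] \<longleftrightarrow> take (length w) a = w \<and> a ! length w = j"
    if "a \<in> answers" for a
    using assms that by (simp add: answers_def take_Suc_conv_app_nth)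
  then show "later w j = later (w @ [j]) 0 \<union> later w (Suc j)"
    and "later (w @ [j]) 0 \<inter> later w (Suc j) = {}"
    using assms by (auto simp: later_def)
qed

lemma later_empty: "\<not> cs w \<Longrightarrow> later w j = {}"
  by (auto simp: later_def answers_def dest: cs_take[of _ "length w"])

lemma rest_Suc: "rest w (Suc j) = rest w j - F (w @ [j])"
  by (simp add: rest_def)

lemma rest_0 [simp]: "rest w 0 = F w"
  by (simp add: rest_def)

lemma rest_nonneg:
  assumes "cs w" "length w < n" "j \<le> m"
  shows "0 \<le> rest w j"
proof -
  have "(\<Sum>d<j. F (w @ [d])) \<le> (\<Sum>d<m. F (w @ [d]))"
    using assms F_nonneg by (intro sum_mono2) auto
  then show ?thesis
    using F_superadditive[OF assms(1,2)] by (simp add: rest_def)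
qed

text \<open>Answers weigh 1 by \<open>F_full\<close>, and superadditivity carries their count
  upwards. The induction is lexicographic because entering a child resets the sibling index. At a
  leaf \<open>j\<close> is 0, since \<open>rest\<close> would otherwise involve values of
  \<open>F\<close> below the leaves, about which nothing is known.\<close>

lemma card_later_le:
  assumes "cs w" "length w < n \<longrightarrow> j \<le> m" "length w = n \<longrightarrow> j = 0"
  shows "real (card (later w j)) \<le> rest w j"
  using assms
proof (induction "(n - length w, m - j)" arbitrary: w j
    rule: wf_induct_rule[OF wf_lex_prod[OF wf_less_than wf_less_than]])
  case 1
  note IH = this(1) and prems = this(2-)
  show ?case
  proof (cases "length w = n")
    case True
    then show ?thesis using prems by (simp add: later_leaf F_full)
  next
    case False
    then have len: "length w < n" using valid prems by fastforce
    show ?thesis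
    proof (cases "j = m")
      case True
      then show ?thesis using len prems rest_nonneg by (simp add: later_last)
    next
      case False
      then have j: "j < m" using prems len by simp
      have "real (card (later (w @ [j]) 0)) \<le> F (w @ [j])"
      proof (cases "cs (w @ [j])")
        case True
        then have "real (card (later (w @ [j]) 0)) \<le> rest (w @ [j]) 0"
          using len by (intro IH) auto
        then show ?thesis by simp
      qed (use len j prems F_nonneg in \<open>simp add: later_empty\<close>)
      moreover have "real (card (later w (Suc j))) \<le> rest w (Suc j)"
        using len j prems by (intro IH) auto
      ultimately show ?thesis
        using card_Un_disjoint[OF finite_later finite_later later_split(2)[OF len]]
        by (simp add: later_split(1)[OF len, of j] rest_Suc)
    qed
  qed
qed

lemma later_root: "later [] 0 = answers"
  by (auto simp: later_def)

lemma card_answers_le: "real (card answers) \<le> F []" if "0 \<le> F []"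
proof (cases "cs []")
  case True
  then show ?thesis using card_later_le[of "[]" 0] later_root by simp
next
  case False
  then show ?thesis using that later_empty[of "[]" 0] by (simp add: later_root)
qed

text \<open>The leaf \<open>a\<close> below \<open>take k a\<close> owns the interval of length \<open>1\<close> starting here, when the children
  of a node \<open>w\<close> partition an initial segment of the interval \<open>{0..<F w}\<close> of that node.\<close>

definition offset :: "nat list \<Rightarrow> nat \<Rightarrow> real" where
  "offset a k = (\<Sum>i=k..<n. \<Sum>d<a ! i. F (take i a @ [d]))"

lemma answers_take: "a \<in> answers \<Longrightarrow> cs (take k a)"
  using cs_take by (simp add: answers_def)

lemma offset_nonneg:
  assumes "a \<in> answers"
  shows "0 \<le> offset a k"
proof -
  have "0 \<le> F (take i a @ [d])" if "i < n" "d < a ! i" for i d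
    using assms that answer_nth_less[of a i]
    by (intro F_nonneg answers_take) (auto simp: answers_def)
  then show ?thesis by (auto simp: offset_def intro!: sum_nonneg)
qed

lemma offset_rec: "k < n \<Longrightarrow> offset a k = (\<Sum>d<a ! k. F (take k a @ [d])) + offset a (Suc k)"
  by (simp add: offset_def sum.atLeast_Suc_lessThan)

text \<open>Induction from the leaf, with offset 0 and weight 1, up to level \<open>k\<close>.
  Nonnegativity of \<open>rest\<close> after child \<open>a ! k\<close> says that this child's
  interval ends inside its parent's.\<close>

lemma offset_le:
  assumes "a \<in> answers" "k \<le> n"
  shows "offset a k + 1 \<le> F (take k a)"
  using assms(2)
proof (induction k rule: inc_induct)
  case base
  then show ?case using assms F_full answers_take[of a n] by (simp add: offset_def answers_def)
next
  case (step k)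
  have len: "length (take k a) = k" using step assms by (simp add: answers_def)
  have "take (Suc k) a = take k a @ [a ! k]"
    using step assms by (simp add: answers_def take_Suc_conv_app_nth)
  moreover have "0 \<le> rest (take k a) (Suc (a ! k))"
    using len step answer_nth_less[OF assms(1), of k] assms by (intro rest_nonneg answers_take) auto
  ultimately show ?case using step offset_rec[of k a] by (simp add: rest_def)
qed

subsection \<open>A single descent\<close>

text \<open>The random coin is conditional on the earlier siblings having been rejected: dividing by
  what is left of \<open>F w\<close> makes the overall chance of child \<open>j\<close> equal to
  \<open>F (w @ [j]) / F w\<close>. If nothing is left, \<open>0 / 0 = 0\<close> rejects the
  child.\<close>

definition walk_prob :: "state \<Rightarrow> real" where
  "walk_prob s = (let v = F (word_at (nreg s 2) s @ [nreg s 3]) in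
     if nreg s 5 = 0 then v / rreg s 1 else of_bool (rreg s 2 < v))"

text \<open>At an inner node, register 3 equal to \<open>m\<close> marks a failed descent. At a leaf
  it is 0, so that real register 1 holds \<open>F w = 1\<close>.\<close>

definition walk_inv :: "state \<Rightarrow> bool" where
  "walk_inv s \<longleftrightarrow> nreg s 0 = n \<and> nreg s 1 = m \<and> nreg s 2 \<le> n \<and>
     (nreg s 2 < n \<longrightarrow> nreg s 3 \<le> m) \<and> (nreg s 2 = n \<longrightarrow> nreg s 3 = 0) \<and>
     cs (word_at (nreg s 2) s) \<and> rreg s 1 = rest (word_at (nreg s 2) s) (nreg s 3)"

text \<open>Variant of the inner loop; its initial value \<open>n * m\<close> is the source of the
  factor |X| |D|.\<close>

definition walk_size :: "state \<Rightarrow> nat" where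
  "walk_size s = (n - nreg s 2) * m - nreg s 3"

text \<open>Reduces the loop body to a coin between \<open>s1\<close> (child entered) and
  \<open>s2\<close> (child rejected). The 11 counts the guard test and the unit steps of the longer,
  deterministic mode. The invariant for \<open>s1\<close> needs a consistent child; an inconsistent
  one has value 0 and is not entered as long as the target is nonnegative.\<close>

lemma walk_step:
  assumes inv: "walk_inv s" and less: "nreg s 2 < n" "nreg s 3 < m"
  defines "w \<equiv> word_at (nreg s 2) s" and "j \<equiv> nreg s 3"
  obtains s1 s2 where
    "\<And>g. wp F c walk_step g (tick 1 s) =
       ennreal (walk_prob s) * g s1 + ennreal (1 - walk_prob s) * g s2"
    "frame s s1" "frame s s2" "clock s1 \<le> clock s + (11 + T)" "clock s2 \<le> clock s + (11 + T)"
    "nreg s1 2 = Suc (nreg s 2)" "nreg s1 3 = 0" "word_at (Suc (nreg s 2)) s1 = w @ [j]"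
    "rreg s1 2 = rreg s 2" "cs (w @ [j]) \<Longrightarrow> walk_inv s1" "walk_size s1 < walk_size s"
    "nreg s2 2 = nreg s 2" "nreg s2 3 = Suc j" "word_at (nreg s 2) s2 = w"
    "rreg s2 2 = rreg s 2 - F (w @ [j])" "walk_inv s2" "walk_size s2 < walk_size s"
proof -
  define i v where "i = nreg s 2" and "v = F (w @ [j])"
  have len: "length w = i" by (simp add: w_def i_def word_at_def)
  have w: "cs w" and i: "i < n" and j: "j < m" and r: "rreg s (Suc 0) = rest w j"
    using inv less by (simp_all add: walk_inv_def w_def j_def i_def)
  have v: "0 \<le> v" "v \<le> rest w j"
    using rest_nonneg[OF w, of "Suc j"] F_nonneg[OF w] len i j
    by (simp_all add: v_def rest_Suc)
  have p: "0 \<le> walk_prob s" "walk_prob s \<le> 1"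
    using v r
    by (auto simp: walk_prob_def Let_def simp flip: w_def j_def v_def intro: divide_le_eq_1[THEN iffD2])
  define k where "k = clock s + (if nreg s 5 = 0 then 6 else 7) + c (w @ [j])"
  define cl where "cl = (cell s)(i := j)"
  have word: "map ((cell s)(i := j)) [0..<Suc i] = w @ [j]"
    by (simp add: w_def i_def word_at_def)
  have suc: "10 + x = Suc (Suc (Suc (Suc (Suc (Suc (Suc (Suc (Suc (Suc x)))))))))"
    "11 + x = Suc (Suc (Suc (Suc (Suc (Suc (Suc (Suc (Suc (Suc (Suc x))))))))))" for x :: nat
    by simp_all
  define s1 where "s1 = s\<lparr>cell := (cell s)(i := j), nreg := (nreg s)(4 := 1, 2 := Suc i, 3 := 0),
    rreg := (rreg s)(3 := v, 4 := walk_prob s, 1 := v), clock := k + 4\<rparr>"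
  define s2 where "s2 = s\<lparr>cell := (cell s)(i := j), nreg := (nreg s)(4 := 0, 3 := Suc j),
    rreg := (rreg s)(3 := v, 4 := walk_prob s, 1 := rest w j - v, 2 := rreg s 2 - v),
    clock := k + 4\<rparr>"
  have wp: "wp F c walk_step g (tick 1 s) =
       ennreal (walk_prob s) * g s1 + ennreal (1 - walk_prob s) * g s2" for g
  proof (cases "nreg s 5 = 0")
    case True
    have "walk_prob s = v / rest w j"
      using True r by (simp add: walk_prob_def v_def w_def j_def)
    then show ?thesis
      using True p by (simp add: walk_step_def wp_Flip word_at_def s1_def s2_def tick_def k_def r word suc
        flip: i_def j_def w_def v_def del: upt_Suc)
  next
    case False
    have "walk_prob s = of_bool (rreg s 2 < v)"
      using False by (simp add: walk_prob_def v_def w_def j_def)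
    then show ?thesis
      using False by (simp add: walk_step_def wp_Flip word_at_def s1_def s2_def tick_def k_def r word suc
        flip: i_def j_def w_def v_def del: upt_Suc)
  qed
  have k: "k + 4 \<le> clock s + (11 + T)"
    using c_child[OF w, of j] len i j by (simp add: k_def)
  have size: "(n - Suc i) * m < (n - i) * m - j" "(n - i) * m - Suc j < (n - i) * m - j"
  proof -
    have "(n - i) * m = (n - Suc i) * m + m"
      using i by (simp add: Suc_diff_Suc flip: add.commute mult_Suc)
    then show "(n - Suc i) * m < (n - i) * m - j" "(n - i) * m - Suc j < (n - i) * m - j"
      using j by simp_all
  qed
  have word1: "word_at (Suc i) s1 = w @ [j]" and word2: "word_at i s2 = w"
    using word by (simp_all add: word_at_def s1_def s2_def)
  have nreg: "nreg s1 2 = Suc i" "nreg s1 3 = 0" "nreg s2 2 = i" "nreg s2 3 = Suc j"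
    by (simp_all add: s1_def s2_def i_def)
  show thesis
  proof (rule that[OF wp])
    show "frame s s1" "frame s s2" by (simp_all add: s1_def s2_def frame_def)
    show "clock s1 \<le> clock s + (11 + T)" "clock s2 \<le> clock s + (11 + T)"
      using k by (simp_all add: s1_def s2_def)
    show "walk_inv s1" if "cs (w @ [j])"
      using that inv i word1 by (simp add: walk_inv_def nreg) (simp add: s1_def v_def)
    show "walk_inv s2"
      using inv i j w word2 by (simp add: walk_inv_def nreg rest_Suc) (simp add: s2_def v_def)
    show "walk_size s1 < walk_size s" "walk_size s2 < walk_size s"
      using size by (simp_all add: walk_size_def nreg i_def j_def)
  qed (use nreg word1 word2 in \<open>simp_all add: i_def v_def, simp_all add: s1_def s2_def v_def\<close>)
qed

lemma wp_walk_loop: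
  assumes "walk_inv s"
  shows "wp F c walk_loop g s =
    (if nreg s 2 < n \<and> nreg s 3 < m then wp F c walk_step (wp F c walk_loop g) (tick 1 s)
     else g (tick 1 s))"
  using assms by (subst walk_loop_def, subst wp_While) (simp add: walk_inv_def walk_loop_def)

section \<open>Random descents\<close>

lemma walk_size_mult: "x < y \<Longrightarrow> x * k + k \<le> y * (k :: nat)"
  using mult_le_mono1[of "Suc x" y k] by simp

text \<open>Expected payoff of a random descent with weight \<open>r\<close> left: every answer in
  \<open>S\<close> is reached with probability \<open>1 / r\<close> and pays \<open>A\<close>;
  otherwise the descent fails and pays \<open>B\<close>. With \<open>r = 0\<close> it must
  fail.\<close>

definition walk_value :: "(nat list \<Rightarrow> real) \<Rightarrow> real \<Rightarrow> nat list set \<Rightarrow> real \<Rightarrow> real" where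
  "walk_value A B S r = (if r = 0 then B else (sum A S + (r - real (card S)) * B) / r)"

lemma walk_value_nonneg:
  "(\<And>a. 0 \<le> A a) \<Longrightarrow> 0 \<le> B \<Longrightarrow> real (card S) \<le> r \<Longrightarrow> 0 \<le> walk_value A B S r"
  by (auto simp: walk_value_def intro!: divide_nonneg_nonneg add_nonneg_nonneg sum_nonneg)

text \<open>One coin preserves uniformity: \<open>v / r * (1 / v)\<close> and
  \<open>(1 - v / r) * (1 / (r - v))\<close> are both \<open>1 / r\<close>. A part of weight 0
  contains no answer by the cardinality bounds, which settles the cases that hit the default in
  \<open>walk_value\<close>.\<close>

lemma walk_value_split:
  assumes "finite S1" "finite S2" "S1 \<inter> S2 = {}" "real (card S1) \<le> v" "real (card S2) \<le> r - v"
  shows "walk_value A B (S1 \<union> S2) r =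
    v / r * walk_value A B S1 v + (1 - v / r) * walk_value A B S2 (r - v)"
proof -
  have c: "real (card (S1 \<union> S2)) = real (card S1) + real (card S2)"
    and s: "sum A (S1 \<union> S2) = sum A S1 + sum A S2"
    using assms by (simp_all add: card_Un_disjoint sum.union_disjoint)
  have "0 \<le> v" "v \<le> r" using assms by linarith+
  then consider "r = 0" "v = 0" | "r \<noteq> 0" "v = 0" | "r \<noteq> 0" "v = r" | "0 < v" "v < r"
    by fastforce
  then show ?thesis
  proof cases
    case 2
    then have "S1 = {}" using assms by simp
    then show ?thesis using 2 by (simp add: walk_value_def)
  next
    case 3
    then have "S2 = {}" using assms by simp
    then show ?thesis using 3 by (simp add: walk_value_def)
  next
    case 4
    then show ?thesis unfolding walk_value_def c s
      by (simp add: field_simps)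
  qed (simp_all add: walk_value_def)
qed

text \<open>Taking the relation \<open>\<le>\<close> or \<open>\<ge>\<close> for \<open>R\<close> gives upper and lower bounds.\<close>

definition mixing :: "(ennreal \<Rightarrow> ennreal \<Rightarrow> bool) \<Rightarrow> bool" where
  "mixing R \<longleftrightarrow> (\<forall>p x y x' y'. R x x' \<longrightarrow> R y y' \<longrightarrow>
     R (ennreal p * x + ennreal (1 - p) * y) (ennreal p * x' + ennreal (1 - p) * y'))"

lemma mixingD: "mixing R \<Longrightarrow> R x x' \<Longrightarrow> R y y' \<Longrightarrow>
    R (ennreal p * x + ennreal (1 - p) * y) (ennreal p * x' + ennreal (1 - p) * y')"
  by (simp add: mixing_def)

lemma mixing_le: "mixing (\<le>)" and mixing_ge: "mixing (\<ge>)"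
  by (auto simp: mixing_def intro!: add_mono mult_left_mono)

text \<open>Induction on the variant, with \<open>walk_value_split\<close> at each coin. Abstract
  \<open>R\<close>, \<open>A\<close> and \<open>B\<close> let one proof serve output probabilities
  (from below) and expected time (from above).\<close>

lemma random_walk_loop:
  assumes R: "mixing R"
    and nonneg: "\<And>a. 0 \<le> A a" "0 \<le> B"
    and "walk_inv s" "nreg s 5 = 0"
    and "\<And>s'. frame s s' \<Longrightarrow> clock s' \<le> clock s + walk_size s * (11 + T) + 1 \<Longrightarrow> nreg s' 2 = n \<Longrightarrow>
        word_at n s' \<in> answers \<Longrightarrow> R (g s') (ennreal (A (word_at n s')))"
    and "\<And>s'. frame s s' \<Longrightarrow> clock s' \<le> clock s + walk_size s * (11 + T) + 1 \<Longrightarrow> nreg s' 2 < n \<Longrightarrow>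
        R (g s') (ennreal B)"
  shows "R (wp F c walk_loop g s)
    (ennreal (walk_value A B (later (word_at (nreg s 2) s) (nreg s 3)) (rreg s 1)))"
  using assms(4-)
proof (induction "walk_size s" arbitrary: s rule: less_induct)
  case less
  let ?w = "word_at (nreg s 2) s" and ?j = "nreg s 3"
  have w: "cs ?w" and r: "rreg s 1 = rest ?w ?j" and len: "length ?w = nreg s 2"
    using less.prems(1) by (simp_all add: walk_inv_def word_at_def)
  show ?case
  proof (cases "nreg s 2 < n \<and> nreg s 3 < m")
    case False
    then consider "nreg s 2 = n" "nreg s 3 = 0" | "nreg s 2 < n" "nreg s 3 = m"
      using less.prems(1) by (fastforce simp: walk_inv_def)
    then show ?thesis
    proof cases
      case 1
      then have "?w \<in> answers" using w len by (simp add: answers_def)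
      moreover have "walk_value A B (later ?w ?j) (rreg s 1) = A ?w"
        using 1 w len by (simp add: walk_value_def r[simplified] later_leaf F_full)
      ultimately show ?thesis
        using 1 False less.prems(3)[of "tick 1 s"] 
        by (simp add: wp_walk_loop[OF less.prems(1)] frame_def)
    next
      case 2
      then have "walk_value A B (later ?w ?j) (rreg s 1) = B"
        using len by (simp add: walk_value_def later_last)
      then show ?thesis
        using 2 False less.prems(4)[of "tick 1 s"] 
        by (simp add: wp_walk_loop[OF less.prems(1)] frame_def)
    qed
  next
    case True
    define p where "p = walk_prob s"
    define v where "v = F (?w @ [?j])"
    obtain s1 s2 where
      wp: "\<And>g. wp F c walk_step g (tick 1 s) = ennreal p * g s1 + ennreal (1 - p) * g s2"
      and s1: "frame s s1" "clock s1 \<le> clock s + (11 + T)"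
        "nreg s1 2 = Suc (nreg s 2)" "nreg s1 3 = 0" "word_at (Suc (nreg s 2)) s1 = ?w @ [?j]"
        "cs (?w @ [?j]) \<Longrightarrow> walk_inv s1" "walk_size s1 < walk_size s"
      and s2: "frame s s2" "clock s2 \<le> clock s + (11 + T)"
        "nreg s2 2 = nreg s 2" "nreg s2 3 = Suc ?j" "word_at (nreg s 2) s2 = ?w"
        "walk_inv s2" "walk_size s2 < walk_size s"
      using walk_step[OF less.prems(1)] True unfolding p_def by metis
    have wps: "wp F c walk_loop g s =
        ennreal p * wp F c walk_loop g s1 + ennreal (1 - p) * wp F c walk_loop g s2"
      using True by (simp add: wp_walk_loop[OF less.prems(1)] wp[simplified])
    have p: "p = v / rest ?w ?j"
      using less.prems(2) r by (simp add: p_def walk_prob_def v_def)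
    have v: "0 \<le> v" "v \<le> rest ?w ?j"
      using rest_nonneg[OF w, of "Suc ?j"] F_nonneg[OF w, of ?j] len True
      by (simp_all add: v_def rest_Suc)
    have bound: "x \<le> clock s' + walk_size s' * (11 + T) + 1 \<Longrightarrow>
        x \<le> clock s + walk_size s * (11 + T) + 1"
      if "clock s' \<le> clock s + (11 + T)" "walk_size s' < walk_size s" for s' x
      using walk_size_mult[OF that(2), of "11 + T"] that(1) by linarith
    let ?S1 = "later (?w @ [?j]) 0" and ?S2 = "later ?w (Suc ?j)"
    have IH2: "R (wp F c walk_loop g s2) (ennreal (walk_value A B ?S2 (rest ?w ?j - v)))"
    proof -
      have "R (wp F c walk_loop g s2)
        (ennreal (walk_value A B (later (word_at (nreg s2 2) s2) (nreg s2 3)) (rreg s2 1)))"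
        using s2 less.prems(2)
        by (intro less.hyps less.prems(3,4) frame_trans[OF s2(1)] bound[OF s2(2,7)])
           (auto simp: frame_def)
      moreover have "rreg s2 1 = rest ?w ?j - v"
        using s2 by (simp add: walk_inv_def rest_Suc v_def)
      ultimately show ?thesis by (simp add: s2)
    qed
    have IH1: "R (wp F c walk_loop g s1) (ennreal (walk_value A B ?S1 v))" if "cs (?w @ [?j])"
    proof -
      have "R (wp F c walk_loop g s1)
        (ennreal (walk_value A B (later (word_at (nreg s1 2) s1) (nreg s1 3)) (rreg s1 1)))"
        using s1 that less.prems(2)
        by (intro less.hyps less.prems(3,4) frame_trans[OF s1(1)] bound[OF s1(2,7)])
           (auto simp: frame_def)
      moreover have "rreg s1 1 = v"
        using s1 that by (simp add: walk_inv_def v_def)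
      ultimately show ?thesis by (simp add: s1)
    qed
    have card2: "real (card ?S2) \<le> rest ?w ?j - v"
      using card_later_le[OF w, of "Suc ?j"] True len by (simp add: rest_Suc v_def)
    have card1: "real (card ?S1) \<le> v"
    proof (cases "cs (?w @ [?j])")
      case True
      then show ?thesis using card_later_le[OF True, of 0] by (simp add: v_def)
    qed (use v in \<open>simp add: later_empty\<close>)
    have p01: "0 \<le> p" "p \<le> 1" using v by (auto simp: p divide_le_eq_1)
    have eq: "walk_value A B (later ?w ?j) (rreg s 1) =
        p * walk_value A B ?S1 v + (1 - p) * walk_value A B ?S2 (rest ?w ?j - v)"
      using walk_value_split[OF finite_later finite_later later_split(2) card1 card2] True len
      by (simp add: p r[simplified] later_split(1)[of ?w ?j])
    show ?thesis
    proof (cases "0 < v")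
      case True
      then have "cs (?w @ [?j])"
        using \<open>nreg s 2 < n \<and> nreg s 3 < m\<close> len w F_pos by (simp add: v_def)
      from mixingD[OF R IH1[OF this] IH2, of p] show ?thesis
        using p01 walk_value_nonneg[of A, OF nonneg card1] walk_value_nonneg[of A, OF nonneg card2]
        by (simp add: wps eq[unfolded One_nat_def] ennreal_mult ennreal_plus)
    next
      \<comment> \<open>The child may be inconsistent, so no induction hypothesis is available for
        it; but it is entered with probability 0.\<close>
      case False
      then have "p = 0" using v by (simp add: p)
      then show ?thesis using IH2 by (simp add: wps eq[unfolded One_nat_def])
    qed
  qed
qed

text \<open>Every coin is 0 or 1, so there is a single final state. Adding the weights of the
  rejected siblings back to real register 2 recovers the position of the target inside the current
  node. If it lies in the unit interval of an answer \<open>a\<close>, every child entered is on the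
  path to \<open>a\<close>.\<close>

lemma target_walk_loop:
  assumes "walk_inv s" "nreg s 5 \<noteq> 0" "0 \<le> rreg s 2"
  obtains s' where "\<And>g. wp F c walk_loop g s = g s'" "frame s s'"
    "clock s' \<le> clock s + walk_size s * (11 + T) + 1"
    "nreg s' 2 \<le> n"
    "nreg s' 2 = n \<Longrightarrow> answers \<noteq> {}"
    "\<And>a. a \<in> later (word_at (nreg s 2) s) (nreg s 3) \<Longrightarrow>
       offset a (nreg s 2) \<le> rreg s 2 + (\<Sum>d<nreg s 3. F (word_at (nreg s 2) s @ [d])) \<Longrightarrow>
       rreg s 2 + (\<Sum>d<nreg s 3. F (word_at (nreg s 2) s @ [d])) < offset a (nreg s 2) + 1 \<Longrightarrow>
       nreg s' 2 = n"
  using assms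
proof (induction "walk_size s" arbitrary: s thesis rule: less_induct)
  case less
  let ?w = "word_at (nreg s 2) s" and ?j = "nreg s 3"
  have w: "cs ?w" and len: "length ?w = nreg s 2" and inv: "nreg s 2 \<le> n"
    using less.prems(2) by (simp_all add: walk_inv_def word_at_def)
  show ?case
  proof (cases "nreg s 2 < n \<and> nreg s 3 < m")
    case False
    then have "nreg s 2 = n \<or> nreg s 2 < n \<and> nreg s 3 = m"
      using less.prems(2) by (fastforce simp: walk_inv_def)
    moreover have "later ?w ?j = {}" if "nreg s 2 < n" "nreg s 3 = m"
      using that later_last[of ?w] len by simp
    moreover have "?w \<in> answers" if "nreg s 2 = n" using that w len by (simp add: answers_def)
    ultimately show ?thesis
      using False inv len
      by (intro less.prems(1)[of "tick 1 s"]) 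
         (auto simp: wp_walk_loop[OF less.prems(2)] frame_def)
  next
    case True
    define v where "v = F (?w @ [?j])"
    define p where "p = walk_prob s"
    obtain s1 s2 where
      wp: "\<And>g. wp F c walk_step g (tick 1 s) = ennreal p * g s1 + ennreal (1 - p) * g s2"
      and s1: "frame s s1" "clock s1 \<le> clock s + (11 + T)"
        "nreg s1 2 = Suc (nreg s 2)" "nreg s1 3 = 0" "word_at (Suc (nreg s 2)) s1 = ?w @ [?j]"
        "rreg s1 2 = rreg s 2"
        "cs (?w @ [?j]) \<Longrightarrow> walk_inv s1" "walk_size s1 < walk_size s"
      and s2: "frame s s2" "clock s2 \<le> clock s + (11 + T)"
        "nreg s2 2 = nreg s 2" "nreg s2 3 = Suc ?j" "word_at (nreg s 2) s2 = ?w"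
        "rreg s2 2 = rreg s 2 - v"
        "walk_inv s2" "walk_size s2 < walk_size s"
      using walk_step[OF less.prems(2)] True unfolding p_def v_def by metis
    have p: "p = of_bool (rreg s 2 < v)"
      using less.prems(3) by (simp add: p_def walk_prob_def v_def)
    have bound: "x \<le> clock s' + walk_size s' * (11 + T) + 1 \<Longrightarrow>
        x \<le> clock s + walk_size s * (11 + T) + 1"
      if "clock s' \<le> clock s + (11 + T)" "walk_size s' < walk_size s" for s' x
      using walk_size_mult[OF that(2), of "11 + T"] that(1) by linarith
    have rec: "offset a (nreg s 2) = (\<Sum>d<a ! nreg s 2. F (?w @ [d])) + offset a (Suc (nreg s 2))"
      if "a \<in> later ?w ?j" for a
      using that offset_rec[of "nreg s 2" a] True len by (simp add: later_def)
    have nonneg: "0 \<le> F (?w @ [d])" if "d < m" for d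
      using F_nonneg[OF w _ that] len True by simp
    show ?thesis
    proof (cases "rreg s 2 < v")
      case less_v: True
      then have "cs (?w @ [?j])"
        using less.prems(4) True len w F_pos by (simp add: v_def)
      then obtain s' where s': "\<And>g. wp F c walk_loop g s1 = g s'" "frame s1 s'"
        "clock s' \<le> clock s1 + walk_size s1 * (11 + T) + 1"
        "nreg s' 2 \<le> n" "nreg s' 2 = n \<Longrightarrow> answers \<noteq> {}"
        "\<And>a. a \<in> later (?w @ [?j]) 0 \<Longrightarrow>
           offset a (Suc (nreg s 2)) \<le> rreg s 2 \<Longrightarrow>
           rreg s 2 < offset a (Suc (nreg s 2)) + 1 \<Longrightarrow> nreg s' 2 = n"
        using less.hyps[OF s1(8)] s1 less.prems(3,4) by (auto simp: frame_def)
      show ?thesis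
      proof (rule less.prems(1)[of s'])
        show "wp F c walk_loop g s = g s'" for g
          using True less_v by (simp add: wp_walk_loop[OF less.prems(2)] wp[simplified] p s')
        show "clock s' \<le> clock s + walk_size s * (11 + T) + 1"
          using bound[OF s1(2,8)] s'(3) by blast
        fix a assume a: "a \<in> later ?w ?j"
          "offset a (nreg s 2) \<le> rreg s 2 + (\<Sum>d<?j. F (?w @ [d]))"
          "rreg s 2 + (\<Sum>d<?j. F (?w @ [d])) < offset a (nreg s 2) + 1"
        \<comment> \<open>Below a later child, the interval of \<open>a\<close> would begin no
          earlier than the end of child \<open>j\<close>, whose interval contains the
          target.\<close>
        have "a ! nreg s 2 = ?j"
        proof (rule ccontr)
          assume "a ! nreg s 2 \<noteq> ?j"
          then have *: "?j < a ! nreg s 2" "a ! nreg s 2 < m"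
            using a(1) len True answer_nth_less by (auto simp: later_def)
          have "(\<Sum>d<Suc ?j. F (?w @ [d])) \<le> (\<Sum>d<a ! nreg s 2. F (?w @ [d]))"
            using * nonneg by (intro sum_mono2) auto
          moreover have "0 \<le> offset a (Suc (nreg s 2))"
            using a(1) by (intro offset_nonneg) (simp add: later_def)
          ultimately show False using less_v a(2) rec[OF a(1)] by (simp add: v_def)
        qed
        then show "nreg s' 2 = n"
          using a rec[OF a(1)] later_split(1)[of ?w ?j] True len
          by (intro s'(6)) (auto simp: later_def)
      qed (use s' s1 frame_trans in \<open>blast+\<close>)
    next
      case ge_v: False
      obtain s' where s': "\<And>g. wp F c walk_loop g s2 = g s'" "frame s2 s'"
        "clock s' \<le> clock s2 + walk_size s2 * (11 + T) + 1"
        "nreg s' 2 \<le> n" "nreg s' 2 = n \<Longrightarrow> answers \<noteq> {}"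
        "\<And>a. a \<in> later ?w (Suc ?j) \<Longrightarrow>
           offset a (nreg s 2) \<le> rreg s 2 - v + (\<Sum>d<Suc ?j. F (?w @ [d])) \<Longrightarrow>
           rreg s 2 - v + (\<Sum>d<Suc ?j. F (?w @ [d])) < offset a (nreg s 2) + 1 \<Longrightarrow>
           nreg s' 2 = n"
        using less.hyps[OF s2(8)] s2 less.prems(3,4) ge_v by (auto simp: frame_def)
      show ?thesis
      proof (rule less.prems(1)[of s'])
        show "wp F c walk_loop g s = g s'" for g
          using True ge_v by (simp add: wp_walk_loop[OF less.prems(2)] wp[simplified] p s')
        show "clock s' \<le> clock s + walk_size s * (11 + T) + 1"
          using bound[OF s2(2,8)] s'(3) by blast
        fix a assume a: "a \<in> later ?w ?j"
          "offset a (nreg s 2) \<le> rreg s 2 + (\<Sum>d<?j. F (?w @ [d]))"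
          "rreg s 2 + (\<Sum>d<?j. F (?w @ [d])) < offset a (nreg s 2) + 1"
        \<comment> \<open>Below child \<open>j\<close>, the interval of \<open>a\<close> would end
          within that child's interval, which the target has already passed.\<close>
        have "a ! nreg s 2 \<noteq> ?j"
        proof
          assume eq: "a ! nreg s 2 = ?j"
          have "take (Suc (nreg s 2)) a = ?w @ [?j]"
            using a(1) eq True len by (simp add: later_def answers_def take_Suc_conv_app_nth)
          then have "offset a (Suc (nreg s 2)) + 1 \<le> v"
            using offset_le[of a "Suc (nreg s 2)"] a(1) True by (simp add: v_def later_def)
          then show False using ge_v a(3) rec[OF a(1)] by (simp add: eq)
        qed
        then show "nreg s' 2 = n"
          using a True len by (intro s'(6)) (auto simp: later_def v_def)
      qed (use s' s2 frame_trans in \<open>blast+\<close>)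
    qed
  qed
qed

subsection \<open>Repeated descents\<close>

text \<open>The only integer in the half-open unit interval of a fixed answer: a round whose
  deterministic descent, if reached, must succeed. Meaningful only if answers exist.\<close>

definition target :: nat where
  "target = nat \<lceil>offset (SOME a. a \<in> answers) 0\<rceil>"

lemma target:
  assumes "answers \<noteq> {}"
  obtains a where "a \<in> answers" "offset a 0 \<le> real target" "real target < offset a 0 + 1"
    "real target < F []"
proof -
  let ?a = "SOME a. a \<in> answers"
  have a: "?a \<in> answers" using assms by (simp add: some_in_eq)
  have "offset ?a 0 \<le> real target" "real target < offset ?a 0 + 1"
    using offset_nonneg[OF a, of 0] by (simp_all add: target_def) linarith
  then show thesis using that[OF a] offset_le[OF a, of 0] by simp
qed

text \<open>By the last conjunct the loop has not passed round \<open>target\<close> without setting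
  the flag; as \<open>target\<close> is below \<open>F []\<close>, it cannot give up while answers
  exist.\<close>

definition trials_inv :: "nat \<Rightarrow> state \<Rightarrow> bool" where
  "trials_inv k s \<longleftrightarrow> nreg s 0 = n \<and> nreg s 1 = m \<and> rreg s 0 = F [] \<and> rreg s 5 = real k \<and>
     nreg s 7 = 0 \<and> (0 < nreg s 6 \<longrightarrow> answers \<noteq> {}) \<and>
     (answers \<noteq> {} \<longrightarrow> 0 < nreg s 6 \<or> k \<le> target)"

definition walk_time :: nat where
  "walk_time = n * m * (11 + T) + 6"

lemma wp_walk:
  assumes "cs []" "nreg s 0 = n" "nreg s 1 = m" "rreg s 0 = F []"
  obtains s0 where "\<And>g. wp F c (walk mode) g s = wp F c walk_loop g s0"
    "walk_inv s0" "nreg s0 2 = 0" "nreg s0 3 = 0" "nreg s0 5 = mode" "rreg s0 2 = rreg s 5"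
    "rreg s0 1 = F []" "clock s0 + walk_size s0 * (11 + T) + 1 = clock s + walk_time"
    "\<And>k. k \<in> {0, 1, 6, 7} \<Longrightarrow> nreg s0 k = nreg s k" "\<And>k. k \<in> {0, 5} \<Longrightarrow> rreg s0 k = rreg s k"
proof (rule that)
  let ?s = "s\<lparr>nreg := (nreg s)(5 := mode, 2 := 0, 3 := 0),
    rreg := (rreg s)(1 := rreg s 0, 2 := rreg s 5), clock := 5 + clock s\<rparr>"
  have suc: "5 + x = Suc (Suc (Suc (Suc (Suc x))))" for x :: nat by simp
  show "wp F c (walk mode) g s = wp F c walk_loop g ?s" for g
    by (simp add: walk_def tick_def suc)
qed (use assms in \<open>auto simp: walk_inv_def walk_size_def walk_time_def word_at_def\<close>)

lemma random_walk:
  assumes R: "mixing R"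
    and nonneg: "\<And>a. 0 \<le> A a" "0 \<le> B"
    and cs: "cs []"
    and s: "nreg s 0 = n" "nreg s 1 = m" "rreg s 0 = F []"
    and success: "\<And>s'. \<forall>k \<in> {0, 1, 6, 7}. nreg s' k = nreg s k \<Longrightarrow> \<forall>k \<in> {0, 5}. rreg s' k = rreg s k \<Longrightarrow>
        clock s' \<le> clock s + walk_time \<Longrightarrow> nreg s' 2 = n \<Longrightarrow>
        word_at n s' \<in> answers \<Longrightarrow> R (g s') (ennreal (A (word_at n s')))"
    and failure: "\<And>s'. \<forall>k \<in> {0, 1, 6, 7}. nreg s' k = nreg s k \<Longrightarrow> \<forall>k \<in> {0, 5}. rreg s' k = rreg s k \<Longrightarrow>
        clock s' \<le> clock s + walk_time \<Longrightarrow> nreg s' 2 < n \<Longrightarrow> R (g s') (ennreal B)"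
  shows "R (wp F c (walk 0) g s) (ennreal (walk_value A B answers (F [])))"
proof -
  obtain s0 where s0: "\<And>g. wp F c (walk 0) g s = wp F c walk_loop g s0"
    "walk_inv s0" "nreg s0 2 = 0" "nreg s0 3 = 0" "nreg s0 5 = 0" "rreg s0 2 = rreg s 5"
    "rreg s0 1 = F []" "clock s0 + walk_size s0 * (11 + T) + 1 = clock s + walk_time"
    "\<And>k. k \<in> {0, 1, 6, 7} \<Longrightarrow> nreg s0 k = nreg s k" "\<And>k. k \<in> {0, 5} \<Longrightarrow> rreg s0 k = rreg s k"
    using wp_walk[OF cs s] by metis
  have "R (wp F c walk_loop g s0)
    (ennreal (walk_value A B (later (word_at (nreg s0 2) s0) (nreg s0 3)) (rreg s0 1)))"
  proof (rule random_walk_loop[OF R nonneg s0(2,5)])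
    fix s' assume "frame s0 s'" and cl: "clock s' \<le> clock s0 + walk_size s0 * (11 + T) + 1"
    then have "\<forall>k \<in> {0, 1, 6, 7}. nreg s' k = nreg s k" "\<forall>k \<in> {0, 5}. rreg s' k = rreg s k"
      using s0(9,10) by (simp_all add: frame_def)
    note * = this cl[unfolded s0(8)]
    show "R (g s') (ennreal (A (word_at n s')))" if "nreg s' 2 = n" "word_at n s' \<in> answers"
      using success[OF * that] .
    show "R (g s') (ennreal B)" if "nreg s' 2 < n"
      using failure[OF * that] .
  qed
  then show ?thesis
    by (simp add: s0(1,3,4) s0(7)[simplified] word_at_def later_root)
qed

lemma target_walk:
  assumes "cs []" "nreg s 0 = n" "nreg s 1 = m" "rreg s 0 = F []" "0 \<le> rreg s 5"
  obtains s' where "\<And>g. wp F c (walk 1) g s = g s'"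
    "\<forall>k \<in> {0, 1, 6, 7}. nreg s' k = nreg s k" "\<forall>k \<in> {0, 5}. rreg s' k = rreg s k"
    "clock s' \<le> clock s + walk_time" "nreg s' 2 \<le> n" "nreg s' 2 = n \<Longrightarrow> answers \<noteq> {}"
    "answers \<noteq> {} \<Longrightarrow> rreg s 5 = real target \<Longrightarrow> nreg s' 2 = n"
proof -
  obtain s0 where s0: "\<And>g. wp F c (walk 1) g s = wp F c walk_loop g s0"
    "walk_inv s0" "nreg s0 2 = 0" "nreg s0 3 = 0" "nreg s0 5 = 1" "rreg s0 2 = rreg s 5"
    "rreg s0 1 = F []" "clock s0 + walk_size s0 * (11 + T) + 1 = clock s + walk_time"
    "\<And>k. k \<in> {0, 1, 6, 7} \<Longrightarrow> nreg s0 k = nreg s k" "\<And>k. k \<in> {0, 5} \<Longrightarrow> rreg s0 k = rreg s k"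
    using wp_walk[OF assms(1-4), of 1] by metis
  have "nreg s0 5 \<noteq> 0" "0 \<le> rreg s0 2" using s0 assms by simp_all
  then obtain s' where s': "\<And>g. wp F c walk_loop g s0 = g s'" "frame s0 s'"
    "clock s' \<le> clock s + walk_time" "nreg s' 2 \<le> n" "nreg s' 2 = n \<Longrightarrow> answers \<noteq> {}"
    "\<And>a. a \<in> answers \<Longrightarrow> offset a 0 \<le> rreg s 5 \<Longrightarrow> rreg s 5 < offset a 0 + 1 \<Longrightarrow> nreg s' 2 = n"
    using target_walk_loop[OF s0(2)]
    by (auto simp: s0(3,4,6) s0(8)[simplified] word_at_def later_root)
  show thesis
  proof (rule that[of s'])
    show "wp F c (walk 1) g s = g s'" for g by (simp add: s0(1)[simplified] s'(1))
    show "nreg s' 2 = n" if "answers \<noteq> {}" "rreg s 5 = real target"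
      using target[OF that(1)] s'(6) that(2) by metis
  qed (use s' s0(9,10) in \<open>auto simp: frame_def\<close>)
qed

text \<open>Two descents, and one unit each for the loop guard, the two branchings, the flag (or
  \<open>Skip\<close>) and the round counter.\<close>

definition trial_time :: nat where
  "trial_time = 2 * walk_time + 5"

text \<open>The deterministic descent does not affect the payoff: it can set the flag only if an
  answer exists, and must set it in round \<open>target\<close>, so either result leads to the
  invariant for \<open>Suc k\<close>.\<close>

lemma wp_trial:
  assumes R: "mixing R"
    and nonneg: "\<And>a. 0 \<le> A a" "0 \<le> B"
    and cs: "cs []"
    and s: "trials_inv k s"
    and success: "\<And>s'. nreg s' 7 = 1 \<Longrightarrow> word_at n s' \<in> answers \<Longrightarrow>
        clock s' \<le> clock s + trial_time \<Longrightarrow> R (g s') (ennreal (A (word_at n s')))"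
    and failure: "\<And>s'. trials_inv (Suc k) s' \<Longrightarrow> clock s' \<le> clock s + trial_time \<Longrightarrow>
        R (g s') (ennreal B)"
  shows "R (wp F c trial g (tick 1 s)) (ennreal (walk_value A B answers (F [])))"
  unfolding trial_def wp_simps(6)
proof (rule random_walk[OF R nonneg cs])
  show "nreg (tick 1 s) 0 = n" "nreg (tick 1 s) 1 = m" "rreg (tick 1 s) 0 = F []"
    using s by (simp_all add: trials_inv_def)
next
  fix s' :: state
  assume s': "\<forall>k \<in> {0, 1, 6, 7}. nreg s' k = nreg (tick 1 s) k"
    "clock s' \<le> clock (tick 1 s) + walk_time" "nreg s' 2 = n" "word_at n s' \<in> answers"
  then show "R (wp F c (If (NLess (NReg 2) (NReg 0))
       (walk 1 ;; If (NLess (NReg 2) (NReg 0)) Skip (NAssign 6 (NConst 1)) ;;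
        RAssign 5 (RPlus (RReg 5) (RConst 1)))
       (NAssign 7 (NConst 1))) g s') (ennreal (A (word_at n s')))"
    using s success[of "tick 1 ((tick 1 s')\<lparr>nreg := (nreg s')(7 := 1)\<rparr>)"]
    by (simp add: trials_inv_def word_at_def trial_time_def)
next
  fix s' :: state
  assume s': "\<forall>k \<in> {0, 1, 6, 7}. nreg s' k = nreg (tick 1 s) k"
    "\<forall>k \<in> {0, 5}. rreg s' k = rreg (tick 1 s) k"
    "clock s' \<le> clock (tick 1 s) + walk_time" "nreg s' 2 < n"
  then have "nreg (tick 1 s') 0 = n" "nreg (tick 1 s') 1 = m" "rreg (tick 1 s') 0 = F []"
    "0 \<le> rreg (tick 1 s') 5"
    using s by (simp_all add: trials_inv_def)
  from target_walk[OF cs this] obtain s'' where s'':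
    "\<And>g. wp F c (walk 1) g (tick 1 s') = g s''"
    "\<forall>k \<in> {0, 1, 6, 7}. nreg s'' k = nreg s' k" "\<forall>k \<in> {0, 5}. rreg s'' k = rreg s' k"
    "clock s'' \<le> clock s' + 1 + walk_time" "nreg s'' 2 \<le> n" "nreg s'' 2 = n \<Longrightarrow> answers \<noteq> {}"
    "answers \<noteq> {} \<Longrightarrow> rreg s' 5 = real target \<Longrightarrow> nreg s'' 2 = n"
    by (metis tick_sel(1,2,4))
  define s3 where "s3 = tick 1 (if nreg s'' 2 < n then tick 1 s''
    else (tick 1 s'')\<lparr>nreg := (nreg s'')(6 := 1)\<rparr>)"
  define s4 where "s4 = tick 1 (s3\<lparr>rreg := (rreg s3)(5 := rreg s3 5 + 1)\<rparr>)"
  have k: "nreg s'' 2 = n" if "answers \<noteq> {}" "k = target"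
    using s s'(2) s''(7) that by (simp add: trials_inv_def)
  have regs: "nreg s4 0 = n" "nreg s4 1 = m" "rreg s4 0 = F []" "rreg s4 5 = real (Suc k)" "nreg s4 7 = 0"
    "nreg s4 6 = (if nreg s'' 2 < n then nreg s 6 else 1)"
    using s s'(1,2) s''(2,3) by (auto simp: s4_def s3_def trials_inv_def)
  have "0 < nreg s 6 \<or> k \<le> target" if "answers \<noteq> {}"
    using s that by (simp add: trials_inv_def)
  moreover have "0 < nreg s 6 \<longrightarrow> answers \<noteq> {}"
    using s by (simp add: trials_inv_def)
  ultimately have "trials_inv (Suc k) s4"
    unfolding trials_inv_def regs using k s''(5,6) by (cases "answers = {}") (auto simp: le_less)
  moreover have "clock s4 \<le> clock s + trial_time"
    using s'(3) s''(4) by (auto simp: s4_def s3_def trial_time_def)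
  ultimately have "R (g s4) (ennreal B)" by (rule failure)
  then show "R (wp F c (If (NLess (NReg 2) (NReg 0))
       (walk 1 ;; If (NLess (NReg 2) (NReg 0)) Skip (NAssign 6 (NConst 1)) ;;
        RAssign 5 (RPlus (RReg 5) (RConst 1)))
       (NAssign 7 (NConst 1))) g s') (ennreal B)"
    using s s' s''(1,2)
    by (simp add: trials_inv_def s4_def s3_def s''(1)[simplified] split: if_splits)
qed

section \<open>The loop over rounds\<close>

lemma wp_trials:
  "wp F c trials g s =
     (if nreg s 7 = 0 \<and> (0 < nreg s 6 \<or> rreg s 5 < rreg s 0)
      then wp F c trial (wp F c trials g) (tick 1 s) else g (tick 1 s))"
  by (subst trials_def, subst wp_While) (simp add: trials_def)

text \<open>Without answers neither descent succeeds, so the loop is left once the round number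
  reaches \<open>F []\<close>. The induction is on the number of rounds to go.\<close>

lemma wp_trials_empty:
  assumes R: "mixing R" and B: "0 \<le> B" and A: "answers = {}" and F: "1 \<le> F []"
    and s: "trials_inv k s"
    and g: "\<And>s'. nreg s' 7 = 0 \<Longrightarrow> clock s' \<le> clock s + trial_time * (nat \<lceil>F []\<rceil> - k) + 1 \<Longrightarrow>
      R (g s') (ennreal B)"
  shows "R (wp F c trials g s) (ennreal B)"
  using s g
proof (induction "nat \<lceil>F []\<rceil> - k" arbitrary: k s)
  case 0
  then have "\<not> rreg s 5 < rreg s 0"
    using F by (simp add: trials_inv_def)
  moreover have "nreg s 6 = 0" "nreg s 7 = 0" using 0 A by (simp_all add: trials_inv_def)
  ultimately show ?case using 0(3)[of "tick 1 s"] by (simp add: wp_trials)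
next
  case (Suc x)
  then have k: "k < nat \<lceil>F []\<rceil>" by simp
  then have "real k < F []" by linarith
  then have guard: "wp F c trials g s = wp F c trial (wp F c trials g) (tick 1 s)"
    using Suc.prems(1) by (simp add: wp_trials trials_inv_def)
  have cs: "cs []" using F F_root by simp
  have "R (wp F c trial (wp F c trials g) (tick 1 s))
      (ennreal (walk_value (\<lambda>_. 0) B answers (F [])))"
  proof (rule wp_trial[OF R _ B cs Suc.prems(1)])
    fix s' assume s': "trials_inv (Suc k) s'" "clock s' \<le> clock s + trial_time"
    have "trial_time * (nat \<lceil>F []\<rceil> - k) = trial_time + trial_time * (nat \<lceil>F []\<rceil> - Suc k)"
      using k by (simp add: Suc_diff_Suc flip: mult_Suc_right)
    then show "R (wp F c trials g s') (ennreal B)"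
      using s' Suc.hyps(2) by (intro Suc.hyps(1)[OF _ s'(1)] Suc.prems(2)) auto
  qed (simp_all add: A)
  then show ?case using F by (simp add: guard walk_value_def A)
qed

text \<open>Before the flag is set, \<open>k \<le> target < F []\<close>; afterwards the round
  number is not consulted. Thus only a random success ends the loop.\<close>

lemma trials_guard:
  assumes "answers \<noteq> {}" "trials_inv k s"
  shows "nreg s 7 = 0 \<and> (0 < nreg s 6 \<or> rreg s 5 < rreg s 0)"
proof -
  have "real target < F []" using target[OF assms(1)] by metis
  then show ?thesis using assms by (auto simp: trials_inv_def)
qed

text \<open>\<open>N\<close> unrolled rounds output \<open>a\<close> with probability at least
  \<open>(1 - q ^ N) / real (card answers)\<close>, a geometric sum; then \<open>N\<close> tends to
  infinity.\<close>

lemma wp_trials_ge: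
  assumes a: "a \<in> answers" and F: "1 \<le> F []" and s: "trials_inv k s"
    and g: "\<And>s. nreg s 7 = 1 \<Longrightarrow> word_at n s = a \<Longrightarrow> 1 \<le> g s"
  shows "ennreal (1 / real (card answers)) \<le> wp F c trials g s"
proof -
  \<comment> \<open>Probability that one random descent fails.\<close>
  define q where "q = (F [] - real (card answers)) / F []"
  have A: "answers \<noteq> {}" using a by blast
  then have card: "0 < card answers" using finite_answers by (simp add: card_gt_0_iff)
  have q: "0 \<le> q" "q < 1" using card card_answers_le F by (simp_all add: q_def)
  have cs: "cs []" using F F_root by simp
  have "ennreal ((1 - q ^ N) / real (card answers)) \<le> wp F c trials g s" for N
    using s
  proof (induction N arbitrary: k s)
    case (Suc N)
    have "ennreal (walk_value (\<lambda>b. of_bool (b = a)) ((1 - q ^ N) / real (card answers)) answers (F []))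
        \<le> wp F c trial (wp F c trials g) (tick 1 s)"
    proof (rule wp_trial[OF mixing_ge _ _ cs Suc.prems])
      show "0 \<le> (1 - q ^ N) / real (card answers)" using q by (simp add: power_le_one)
      show "ennreal (of_bool (word_at n s' = a)) \<le> wp F c trials g s'" if "nreg s' 7 = 1" for s'
        using that g[of "tick 1 s'"] by (simp add: wp_trials)
    qed (use Suc.IH in auto)
    also have "\<dots> = wp F c trials g s"
      using trials_guard[OF A Suc.prems] by (simp add: wp_trials[of g s])
    also have "walk_value (\<lambda>b. of_bool (b = a)) ((1 - q ^ N) / real (card answers)) answers (F [])
        = (1 - q ^ Suc N) / real (card answers)"
    proof -
      have c: "F [] - real (card answers) = q * F []"
        using F by (simp add: q_def)
      have "walk_value (\<lambda>b. of_bool (b = a)) ((1 - q ^ N) / real (card answers)) answers (F [])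
          = (1 + q * F [] * ((1 - q ^ N) / real (card answers))) / F []"
        using a F finite_answers
        by (simp add: walk_value_def c sum.If_cases of_bool_def)
      also have "\<dots> = (real (card answers) + q * F [] * (1 - q ^ N)) / (real (card answers) * F [])"
        using card F by (simp add: field_simps)
      also have "real (card answers) + q * F [] * (1 - q ^ N) = F [] * (1 - q ^ Suc N)"
        using c by (simp add: algebra_simps)
      finally show ?thesis using F by simp
    qed
    finally show ?case .
  qed simp
  moreover have "(\<lambda>N. ennreal ((1 - q ^ N) / real (card answers)))
      \<longlonglongrightarrow> ennreal ((1 - 0) / real (card answers))"
    using q card by (intro tendsto_intros LIMSEQ_power_zero) auto
  ultimately show ?thesis by (intro LIMSEQ_le_const2) auto
qed

text \<open>If \<open>q\<close> is the failure probability of a random descent, then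
  \<open>trial_time * F [] / card answers\<close> solves \<open>E = trial_time + q * E\<close>.
  Hence the clock plus \<open>E\<close>, up to a constant, is a superinvariant.\<close>

lemma wp_trials_time:
  assumes A: "answers \<noteq> {}" and F: "1 \<le> F []" and s: "trials_inv k s"
  shows "wp F c trials (\<lambda>s. ennreal (real (clock s + 1))) s \<le>
    ennreal (real (clock s) + trial_time * F [] / real (card answers) + 2)"
proof -
  have card: "0 < card answers" using A finite_answers by (auto simp: card_gt_0_iff)
  have cs: "cs []" using F F_root by simp
  define E where "E = trial_time * F [] / real (card answers)"
  have E: "0 \<le> E" using F by (simp add: E_def)
  \<comment> \<open>The 2 covers the last guard test and the assignment after the loop. Infinity
    makes the obligation trivial outside the invariant.\<close>
  define I where "I s = (if nreg s 7 = 1 then ennreal (real (clock s) + 2)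
    else if \<exists>k. trials_inv k s then ennreal (real (clock s) + E + 2) else \<infinity>)" for s
  have I1: "I s = ennreal (real (clock s) + 2)" if "nreg s 7 = 1" for s
    using that by (simp add: I_def)
  have I0: "I s = ennreal (real (clock s) + E + 2)" if "trials_inv k s" for k s
    using that by (auto simp: I_def trials_inv_def)
  have "wp F c trials (\<lambda>s. ennreal (real (clock s + 1))) s \<le> I s"
    unfolding trials_def
  proof (rule wp_While_le)
    fix s
    assume *: "\<not> bval (BAnd (NLess (NReg 7) (NConst 1))
      (BNot (BAnd (NLess (NReg 6) (NConst 1)) (BNot (RLess (RReg 5) (RReg 0)))))) s"
    show "ennreal (real (clock (tick 1 s) + 1)) \<le> I s"
      using * by (auto simp: I_def dest!: trials_guard[OF A])
  next
    fix s
    assume *: "bval (BAnd (NLess (NReg 7) (NConst 1))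
      (BNot (BAnd (NLess (NReg 6) (NConst 1)) (BNot (RLess (RReg 5) (RReg 0)))))) s"
    show "wp F c trial I (tick 1 s) \<le> I s"
    proof (cases "\<exists>k. trials_inv k s")
      case True
      then obtain k where k: "trials_inv k s" ..
      have "wp F c trial I (tick 1 s) \<le> ennreal (walk_value (\<lambda>_. real (clock s + trial_time) + 2)
          (real (clock s + trial_time) + E + 2) answers (F []))"
        by (rule wp_trial[OF mixing_le _ _ cs k])
           (use E in \<open>auto simp: I1 I0 simp flip: of_nat_add intro!: ennreal_leI\<close>)
      also have "walk_value (\<lambda>_. real (clock s + trial_time) + 2)
          (real (clock s + trial_time) + E + 2) answers (F []) = real (clock s) + E + 2"
        using F card by (simp add: walk_value_def E_def field_simps)
      finally show ?thesis by (simp add: I0[OF k])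
    qed (use * in \<open>simp add: I_def\<close>)
  qed
  also have "I s = ennreal (real (clock s) + E + 2)" by (rule I0[OF s])
  finally show ?thesis by (simp add: E_def)
qed

lemma answers_no_domain: "0 < n \<Longrightarrow> m = 0 \<Longrightarrow> answers = {}"
  using answer_nth_less by fastforce

lemma answers_small: "0 \<le> F [] \<Longrightarrow> F [] < 1 \<Longrightarrow> answers = {}"
  using card_answers_le finite_answers card_0_eq by fastforce

section \<open>The whole program\<close>

lemma wp_sampler:
  assumes "0 \<le> F []"
  obtains s where "1 \<le> F []" "\<not> (0 < n \<and> m = 0)" "trials_inv 0 s" "clock s \<le> T + 3"
    "\<And>g. wp F c sampler g (init_state n m) = wp F c trials (wp F c (NAssign 0 (NReg 7)) g) s"
  | s where "clock s \<le> T + 4" "nreg s 0 = 0" "answers = {}"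
    "\<And>g. wp F c sampler g (init_state n m) = g s"
proof -
  consider "0 < n" "m = 0" | "\<not> (0 < n \<and> m = 0)" "F [] < 1" | "\<not> (0 < n \<and> m = 0)" "1 \<le> F []"
    by linarith
  then show thesis
  proof cases
    case 1
    let ?s = "tick 1 (tick 1 (init_state n m)\<lparr>nreg := (nreg (init_state n m))(0 := 0)\<rparr>)"
    show ?thesis
      by (rule that(2)[of ?s])
         (use 1 answers_no_domain in \<open>simp_all add: sampler_def init_state_def\<close>)
  next
    case 2
    let ?s0 = "tick (2 + c []) (tick 1 (init_state n m)\<lparr>rreg := (rreg (init_state n m))(0 := F [])\<rparr>)"
    let ?s = "tick 1 (?s0\<lparr>nreg := (nreg ?s0)(0 := 0)\<rparr>)"
    show ?thesis
      by (rule that(2)[of ?s])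
         (use 2 answers_small assms c_root in
           \<open>auto simp: sampler_def init_state_def word_at_def tick_def\<close>)
  next
    case 3
    let ?s0 = "tick (2 + c []) (tick 1 (init_state n m)\<lparr>rreg := (rreg (init_state n m))(0 := F [])\<rparr>)"
    have "trials_inv 0 ?s0" by (simp add: trials_inv_def init_state_def)
    then show ?thesis
      by (rule that(1)[OF 3(2,1), of ?s0])
         (use 3 c_root in \<open>auto simp: sampler_def init_state_def word_at_def tick_def\<close>)
  qed
qed

lemma sampler_empty:
  assumes "0 \<le> F []" "answers = {}"
  shows "1 \<le> wp F c sampler (indicator {s. nreg s 0 = 0}) (init_state n m)"
  using assms(1)
proof (cases rule: wp_sampler)
  case (1 s)
  have "1 \<le> wp F c trials (wp F c (NAssign 0 (NReg 7)) (indicator {s. nreg s 0 = 0})) s"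
    using wp_trials_empty[OF mixing_ge _ assms(2) 1(1,3), of 1
        "wp F c (NAssign 0 (NReg 7)) (indicator {s. nreg s 0 = 0})"] by simp
  then show ?thesis by (simp only: 1)
qed simp

lemma sampler_answer:
  assumes "0 \<le> F []" and a: "a \<in> answers"
  shows "ennreal (1 / real (card answers)) \<le>
    wp F c sampler (indicator {s. nreg s 0 \<noteq> 0 \<and> word_at n s = a}) (init_state n m)"
  using assms(1)
proof (cases rule: wp_sampler)
  case (1 s)
  show ?thesis
    unfolding 1(5) by (rule wp_trials_ge[OF a 1(1,3)]) (simp add: word_at_def)
qed (use a in simp)

text \<open>The maximum with 1 absorbs the early exits and the case \<open>n = 0\<close>, where the
  main factor can be 0.\<close>

lemma sampler_time:
  assumes F: "0 \<le> F []" and T: "1 \<le> T"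
  shows "wp F c sampler (\<lambda>s. of_nat (clock s)) (init_state n m) \<le>
    ennreal (100 * max 1 (F [] / max 1 (real (card answers)) * real n * real m) * real T)"
  using assms(1)
proof (cases rule: wp_sampler)
  case (2 s)
  have "real (clock s) \<le> 100 * 1 * real T" using 2(1) T by simp
  also have "\<dots> \<le> 100 * max 1 (F [] / max 1 (real (card answers)) * real n * real m) * real T"
    by (intro mult_right_mono mult_left_mono) auto
  finally show ?thesis
    by (simp add: 2(4) ennreal_leI flip: ennreal_of_nat_eq_real_of_nat)
next
  case (1 s)
  \<comment> \<open>41 is 24 + 17: two descents with \<open>11 + T \<le> 12 * T\<close>, and
    \<open>17 = 2 * 6 + 5\<close> further unit steps.\<close>
  have K: "real trial_time \<le> 41 * x * real T" if "real n * real m \<le> x" "1 \<le> x" for x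
  proof -
    have "real trial_time = 2 * (real n * real m * (11 + real T)) + 17"
      by (simp add: trial_time_def walk_time_def)
    also have "real n * real m * (11 + real T) \<le> x * (12 * real T)"
      using that T by (intro mult_mono) auto
    also have "17 \<le> 17 * (x * real T)"
      using mult_mono[of 1 x 1 "real T"] that T by simp
    finally show ?thesis by simp
  qed
  let ?X = "F [] / max 1 (real (card answers)) * real n * real m"
  have T4: "real (clock s) + 2 \<le> 6 * real T" using 1(4) T by simp
  have M: "real T \<le> max 1 ?X * real T" "?X * real T \<le> max 1 ?X * real T"
    using T mult_right_mono[of 1 "max 1 ?X" "real T"] by (simp, intro mult_right_mono) auto
  have wp: "wp F c sampler (\<lambda>s. of_nat (clock s)) (init_state n m)
      = wp F c trials (\<lambda>s. ennreal (real (clock s + 1))) s"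
    unfolding 1(5) by (intro arg_cong[where f = "\<lambda>g. wp F c trials g s"] ext)
      (simp add: ennreal_of_nat_eq_real_of_nat)
  have nm: "1 \<le> real n * real m" if "0 < n"
    using that 1(2) mult_mono[of 1 "real n" 1 "real m"] by simp
  show ?thesis
  proof (cases "answers = {}")
    case True
    \<comment> \<open>For \<open>n = 0\<close> the empty word would be an answer, as
      \<open>1 \<le> F []\<close> makes the root consistent.\<close>
    have n: "0 < n"
    proof (rule ccontr)
      assume "\<not> 0 < n"
      then have "[] \<in> answers" using F_root 1(1) unfolding answers_def by simp
      with True show False by simp
    qed
    have "wp F c trials (\<lambda>s. ennreal (real (clock s + 1))) s
        \<le> ennreal (real (clock s) + trial_time * nat \<lceil>F []\<rceil> + 2)"
    proof (rule wp_trials_empty[OF mixing_le _ True 1(1,3)])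
      fix s' :: state
      assume "clock s' \<le> clock s + trial_time * (nat \<lceil>F []\<rceil> - 0) + 1"
      then have "real (clock s') \<le> real (clock s + trial_time * nat \<lceil>F []\<rceil> + 1)"
        unfolding of_nat_le_iff by simp
      then show "ennreal (real (clock s' + 1))
          \<le> ennreal (real (clock s) + trial_time * nat \<lceil>F []\<rceil> + 2)"
        by (intro ennreal_leI) simp
    qed simp
    also have "real (clock s) + trial_time * nat \<lceil>F []\<rceil> + 2 \<le> 100 * max 1 ?X * real T"
    proof -
      \<comment> \<open>Rounding up costs at most a factor 2 since \<open>1 \<le> F []\<close>; this
        gives 82, and \<open>T4\<close> adds 6, which stays below 100.\<close>
      have "real (nat \<lceil>F []\<rceil>) \<le> 2 * F []" using 1(1) by linarith
      then have "real trial_time * real (nat \<lceil>F []\<rceil>) \<le> (41 * (real n * real m) * real T) * (2 * F [])"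
        using K[OF order_refl nm[OF n]] by (intro mult_mono) auto
      also have "\<dots> = 82 * (?X * real T)" by (simp add: True)
      finally show ?thesis using M T4 unfolding of_nat_mult by linarith
    qed
    finally show ?thesis by (simp add: wp ennreal_leI)
  next
    case False
    then have card: "1 \<le> real (card answers)"
      using finite_answers by (simp add: Suc_le_eq card_gt_0_iff)
    have "trial_time * F [] / real (card answers) \<le> 41 * max 1 ?X * real T"
    proof (cases "0 < n")
      case True
      have "trial_time * (F [] / real (card answers))
          \<le> 41 * (real n * real m) * real T * (F [] / real (card answers))"
        using K[OF order_refl nm[OF True]] 1(1) by (intro mult_right_mono) auto
      also have "\<dots> = 41 * (?X * real T)" using card by (simp add: max_def)
      finally show ?thesis using M unfolding times_divide_eq_right[symmetric] by linarith
    next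
      \<comment> \<open>Without variables the root is the only answer and has value 1, so the bound
        rests on the 1 in \<open>max 1\<close>.\<close>
      case False
      then have "F [] = 1" using F_root F_full[of "[]"] 1(1) by simp
      then have "trial_time * F [] / real (card answers) \<le> trial_time"
        using card by (simp add: divide_le_eq mult_le_cancel_left1)
      also have "\<dots> \<le> 41 * 1 * real T" using False by (intro K) auto
      finally show ?thesis using M by linarith
    qed
    then have "real (clock s) + trial_time * F [] / real (card answers) + 2
        \<le> 100 * max 1 ?X * real T"
      using M(1) T4 of_nat_0_le_iff[of T, where 'a = real] by argo
    then show ?thesis
      unfolding wp using wp_trials_time[OF False 1(1,3)] by (meson ennreal_leI order_trans)
  qed
qed

end

section \<open>Words as tuples\<close>

lemma decode_Nil [simp]: "decode xs ds [] = Map.empty"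
  by (simp add: decode_def)

lemma decode_take: "decode xs ds w = map_of (zip (take (length w) xs) (map ((!) ds) w))"
  using zip_append2[of xs "map ((!) ds) w" "[]"] by (simp add: decode_def)

lemma dom_decode: "length w \<le> length xs \<Longrightarrow> dom (decode xs ds w) = set (take (length w) xs)"
  by (simp add: decode_take dom_map_of_zip)

lemma decode_tuples:
  assumes "length w \<le> length xs" "set w \<subseteq> {..<length ds}"
  shows "decode xs ds w \<in> tuples (set (take (length w) xs)) (set ds)"
proof -
  have "ran (decode xs ds w) \<subseteq> set (map ((!) ds) w)"
    by (auto simp: decode_def ran_def dest!: map_of_SomeD set_zip_rightD)
  moreover have "set (map ((!) ds) w) \<subseteq> set ds"
    using assms(2) by auto
  ultimately show ?thesis using dom_decode[OF assms(1), of ds] by (auto simp: tuples_def)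
qed

lemma nth_notin_dom_decode:
  "distinct xs \<Longrightarrow> length w < length xs \<Longrightarrow> xs ! length w \<notin> dom (decode xs ds w)"
  by (simp add: dom_decode in_set_conv_nth nth_eq_iff_index_eq)

lemma decode_snoc:
  assumes "distinct xs" "length w < length xs"
  shows "decode xs ds (w @ [d]) = (decode xs ds w)(xs ! length w \<mapsto> ds ! d)"
proof -
  have "decode xs ds (w @ [d]) = [xs ! length w \<mapsto> ds ! d] ++ decode xs ds w"
    using assms by (simp add: decode_take take_Suc_conv_app_nth)
  also have "\<dots> = decode xs ds w ++ [xs ! length w \<mapsto> ds ! d]"
    using nth_notin_dom_decode[OF assms, of ds] by (intro map_add_comm) simp
  finally show ?thesis by simp
qed

section \<open>Consistency and answers\<close>

lemma consistent_iff:
  "consistent Q \<tau> \<longleftrightarrow> (\<forall>(XR, R) \<in> Q. \<exists>\<sigma> \<in> R. \<sigma> |` dom \<tau> = \<tau> |` XR)"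
  by (auto simp: consistent_def section_of_def split_beta)

lemma restrict_dom: "\<tau> \<subseteq>\<^sub>m \<tau>' \<Longrightarrow> \<tau>' |` dom \<tau> = \<tau>"
  by (rule ext) (auto simp: map_le_def restrict_map_def domIff)

lemma consistent_map_le:
  assumes le: "\<tau> \<subseteq>\<^sub>m \<tau>'" and "consistent Q \<tau>'"
  shows "consistent Q \<tau>"
proof -
  have "\<sigma> |` dom \<tau> = \<tau> |` XR" if "\<sigma> |` dom \<tau>' = \<tau>' |` XR" for \<sigma> XR
  proof -
    have "\<sigma> |` dom \<tau> = (\<sigma> |` dom \<tau>') |` dom \<tau>"
      using map_le_implies_dom_le[OF le] by (simp add: Int_absorb1)
    also have "\<dots> = (\<tau>' |` dom \<tau>) |` XR"
      by (simp add: that Int_commute)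
    finally show ?thesis by (simp add: restrict_dom[OF le])
  qed
  then show ?thesis using assms(2) by (fastforce simp: consistent_iff)
qed

text \<open>Once all variables are assigned, restricting \<open>\<sigma>\<close> to the domain of
  \<open>\<tau>\<close> changes nothing, so a match in \<open>R\<close> is the restriction of
  \<open>\<tau>\<close> itself.\<close>

lemma ans_iff_consistent:
  assumes "join_query X D Q" "\<tau> \<in> tuples X D"
  shows "\<tau> \<in> ans X D Q \<longleftrightarrow> consistent Q \<tau>"
proof -
  have "\<tau> |` XR \<in> R \<longleftrightarrow> (\<exists>\<sigma> \<in> R. \<sigma> |` dom \<tau> = \<tau> |` XR)" if "(XR, R) \<in> Q" for XR R
  proof -
    have "XR \<subseteq> X" "R \<subseteq> tuples XR D"
      using assms(1) that by (auto simp: join_query_def)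
    then have "\<sigma> |` dom \<tau> = \<sigma>" if "\<sigma> \<in> R" for \<sigma>
    proof -
      have "dom \<sigma> \<subseteq> dom \<tau>"
        using that \<open>XR \<subseteq> X\<close> \<open>R \<subseteq> tuples XR D\<close> assms(2) by (auto simp: tuples_def)
      then show ?thesis by (intro ext) (metis domIff restrict_map_def subsetD)
    qed
    then show ?thesis by auto
  qed
  then show ?thesis using assms(2) by (auto simp: ans_def consistent_iff)
qed

definition consistent_word ::
    "'x list \<Rightarrow> 'd list \<Rightarrow> ('x, 'd) relation set \<Rightarrow> nat list \<Rightarrow> bool" where
  "consistent_word xs ds Q w \<longleftrightarrow>
     length w \<le> length xs \<and> set w \<subseteq> {..<length ds} \<and> consistent Q (decode xs ds w)"

text \<open>Even an inconsistent child is a node if its parent is consistent, so the estimator and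
  cost bounds apply to every query.\<close>

lemma decode_snoc_trace_nodes:
  assumes "distinct xs" "consistent_word xs ds Q w" "length w < length xs" "d < length ds"
  shows "decode xs ds (w @ [d]) \<in> trace_nodes xs (set ds) Q"
  unfolding trace_nodes_def decode_snoc[OF assms(1,3)]
  by (rule UnI2, rule CollectI, rule exI[of _ "decode xs ds w"], rule exI[of _ "length w"],
      rule exI[of _ "ds ! d"])
     (use assms decode_tuples[of w xs ds] in \<open>simp add: consistent_word_def\<close>)

lemma word_estimator_decode:
  assumes xs: "distinct xs" and ds: "distinct ds" and Q: "join_query (set xs) (set ds) Q"
    and est: "estimator xs (set ds) Q q"
    and cost: "\<And>\<tau>. \<tau> \<in> trace_nodes xs (set ds) Q \<Longrightarrow> cost \<tau> \<le> T"
  shows "word_estimator (length xs) (length ds) T (q \<circ> decode xs ds) (cost \<circ> decode xs ds)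
    (consistent_word xs ds Q)"
proof
  fix w
  assume w: "consistent_word xs ds Q w"
  then show "length w \<le> length xs \<and> set w \<subseteq> {..<length ds}"
    by (simp add: consistent_word_def)
  show "(q \<circ> decode xs ds) w = 1" if "length w = length xs"
    using w that est ans_iff_consistent[OF Q] decode_tuples[of w xs ds]
    by (auto simp: consistent_word_def estimator_def)
next
  fix w d
  assume *: "consistent_word xs ds Q (w @ [d])"
  then have "decode xs ds w \<subseteq>\<^sub>m decode xs ds (w @ [d])"
    using nth_notin_dom_decode[OF xs, of w ds]
    by (auto simp: consistent_word_def decode_snoc[OF xs] map_le_def)
  from consistent_map_le[OF this] * show "consistent_word xs ds Q w"
    by (auto simp: consistent_word_def)
next
  fix w d
  assume w: "consistent_word xs ds Q w" and len: "length w < length xs" and d: "d < length ds"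
  note node = decode_snoc_trace_nodes[OF xs w len d]
  show "0 \<le> (q \<circ> decode xs ds) (w @ [d])"
    using est node by (simp add: estimator_def)
  show "(cost \<circ> decode xs ds) (w @ [d]) \<le> T"
    using cost[OF node] by simp
  show "consistent_word xs ds Q (w @ [d])" if "0 < (q \<circ> decode xs ds) (w @ [d])"
  proof -
    have "consistent Q (decode xs ds (w @ [d]))"
      using est node that by (force simp: estimator_def)
    then show ?thesis using w len d by (simp add: consistent_word_def)
  qed
next
  fix w
  assume w: "consistent_word xs ds Q w" and len: "length w < length xs"
  have "(\<Sum>d<length ds. (q \<circ> decode xs ds) (w @ [d]))
      = (\<Sum>d<length ds. q ((decode xs ds w)(xs ! length w \<mapsto> ds ! d)))"
    by (simp add: decode_snoc[OF xs len])
  also have "\<dots> = (\<Sum>d\<in>set ds. q ((decode xs ds w)(xs ! length w \<mapsto> d)))"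
    by (rule sum.reindex_bij_betw) (rule bij_betw_nth[OF ds refl refl])
  also have "\<dots> \<le> q (decode xs ds w)"
    using est w len decode_tuples[of w xs ds] by (simp add: estimator_def consistent_word_def)
  finally show "(\<Sum>d<length ds. (q \<circ> decode xs ds) (w @ [d])) \<le> (q \<circ> decode xs ds) w"
    by simp
next
  have root: "Map.empty \<in> trace_nodes xs (set ds) Q" by (simp add: trace_nodes_def)
  show "(cost \<circ> decode xs ds) [] \<le> T" using cost[OF root] by simp
  show "consistent_word xs ds Q []" if "0 < (q \<circ> decode xs ds) []"
    using est root that by (force simp: estimator_def consistent_word_def)
qed

lemma bij_betw_decode:
  assumes xs: "distinct xs" and ds: "distinct ds" and Q: "join_query (set xs) (set ds) Q"
  shows "bij_betw (decode xs ds) {w. consistent_word xs ds Q w \<and> length w = length xs}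
    (ans (set xs) (set ds) Q)"
  unfolding bij_betw_def
proof
  show "inj_on (decode xs ds) {w. consistent_word xs ds Q w \<and> length w = length xs}"
  proof (rule inj_onI)
    fix v w
    assume v: "v \<in> {w. consistent_word xs ds Q w \<and> length w = length xs}"
      and w: "w \<in> {w. consistent_word xs ds Q w \<and> length w = length xs}"
      and eq: "decode xs ds v = decode xs ds w"
    have "map ((!) ds) v = map ((!) ds) w"
      using v w eq xs by (intro map_of_zip_inject[of _ xs]) (auto simp: decode_def)
    moreover have "inj_on ((!) ds) (set v \<union> set w)"
      using v w ds by (intro inj_on_nth) (auto simp: consistent_word_def)
    ultimately show "v = w" by (simp add: inj_on_map_eq_map)
  qed
  show "decode xs ds ` {w. consistent_word xs ds Q w \<and> length w = length xs}
      = ans (set xs) (set ds) Q"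
  proof
    show "decode xs ds ` {w. consistent_word xs ds Q w \<and> length w = length xs}
        \<subseteq> ans (set xs) (set ds) Q"
    proof (rule image_subsetI)
      fix w assume w: "w \<in> {w. consistent_word xs ds Q w \<and> length w = length xs}"
      then have "decode xs ds w \<in> tuples (set xs) (set ds)"
        using decode_tuples[of w xs ds] by (simp add: consistent_word_def)
      from ans_iff_consistent[OF Q this] w show "decode xs ds w \<in> ans (set xs) (set ds) Q"
        by (simp add: consistent_word_def)
    qed
    show "ans (set xs) (set ds) Q
        \<subseteq> decode xs ds ` {w. consistent_word xs ds Q w \<and> length w = length xs}"
    proof
      fix \<tau> assume ans: "\<tau> \<in> ans (set xs) (set ds) Q"
      then have \<tau>: "dom \<tau> = set xs" "ran \<tau> \<subseteq> set ds" "\<tau> \<in> tuples (set xs) (set ds)"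
        by (auto simp: ans_def tuples_def)
      have "\<exists>i < length ds. \<tau> x = Some (ds ! i)" if "x \<in> set xs" for x
      proof -
        have "x \<in> dom \<tau>" using that \<tau>(1) by simp
        then obtain y where y: "\<tau> x = Some y" by auto
        then have "y \<in> set ds" using \<tau>(2) ranI by fastforce
        then show ?thesis using y unfolding in_set_conv_nth by metis
      qed
      then obtain f where f: "\<And>x. x \<in> set xs \<Longrightarrow> f x < length ds \<and> \<tau> x = Some (ds ! f x)"
        by metis
      have "decode xs ds (map f xs) = \<tau>"
      proof
        fix x
        have "\<tau> x = None" if "x \<notin> set xs" using that \<tau>(1) by (metis domIff)
        then show "decode xs ds (map f xs) x = \<tau> x"
          using f[of x] by (cases "x \<in> set xs") (simp_all add: decode_def map_of_zip_map o_def)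
      qed
      moreover have "consistent Q \<tau>" using ans ans_iff_consistent[OF Q \<tau>(3)] by simp
      ultimately show "\<tau> \<in> decode xs ds ` {w. consistent_word xs ds Q w \<and> length w = length xs}"
        using f by (intro image_eqI[of _ _ "map f xs"]) (auto simp: consistent_word_def)
    qed
  qed
qed

text \<open>The lower bounds add up to 1, the largest possible mass, so none of them can be strict.
  Hence lower bounds on output probabilities suffice.\<close>

lemma uniformly_samplesI:
  assumes S: "finite S"
    and empty: "S = {} \<Longrightarrow> ennreal 1 \<le> ennreal (spmf p Empty)"
    and sample: "\<And>a. a \<in> S \<Longrightarrow> ennreal (1 / real (card S)) \<le> ennreal (spmf p (Sample a))"
  shows "uniformly_samples p S"
proof (cases "S = {}")
  case True
  then have "1 \<le> spmf p Empty"
    using empty by (simp only: ennreal_le_iff pmf_nonneg)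
  then have "spmf p Empty = 1" by (rule antisym[OF pmf_le_1])
  then show ?thesis using True by (simp add: uniformly_samples_def)
next
  case False
  have ge: "1 / real (card S) \<le> spmf p (Sample a)" if "a \<in> S" for a
    using sample[OF that] by (simp only: ennreal_le_iff pmf_nonneg)
  have "(\<Sum>a\<in>S. spmf p (Sample a)) = measure (measure_spmf p) (Sample ` S)"
    using S by (subst measure_spmf.finite_measure_eq_sum_singleton)
      (simp_all add: sum.reindex inj_on_def spmf_conv_measure_spmf)
  also have "\<dots> \<le> 1" by (rule measure_spmf.subprob_measure_le_1)
  finally have sum: "(\<Sum>a\<in>S. spmf p (Sample a)) \<le> (\<Sum>a\<in>S. 1 / real (card S))"
    using S False by simp
  have "spmf p (Sample a) = 1 / real (card S)" if a: "a \<in> S" for a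
  proof (rule ccontr)
    assume "spmf p (Sample a) \<noteq> 1 / real (card S)"
    with ge[OF a] have "1 / real (card S) < spmf p (Sample a)" by simp
    with S a ge have "(\<Sum>a\<in>S. 1 / real (card S)) < (\<Sum>a\<in>S. spmf p (Sample a))"
      by (intro sum_strict_mono_ex1) blast+
    with sum show False by simp
  qed
  then show ?thesis using False by (simp add: uniformly_samples_def)
qed

lemma wp_indicator_le_spmf:
  assumes "A \<subseteq> h -` {x}"
  shows "wp f c p (indicator A) s \<le> ennreal (spmf (map_spmf h (exec f c p s)) x)"
  using assms by (simp add: wp_def ennreal_spmf_map emeasure_mono)

text \<open>Program and constant come first, hence are uniform in all instances. The maximum with 1
  is there because the factor can vanish while every run takes some time.\<close>

theorem theorem14:
  shows "\<exists>(prog :: com) (C :: real).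
    \<forall>(xs :: 'x list) (ds :: 'd list) X D (Q :: ('x, 'd) relation set)
      (q_upb :: ('x, 'd) tuple \<Rightarrow> real) (cost :: ('x, 'd) tuple \<Rightarrow> nat) (t :: real).
      distinct xs \<longrightarrow> set xs = X \<longrightarrow> distinct ds \<longrightarrow> set ds = D \<longrightarrow>
      join_query X D Q \<longrightarrow> estimator xs D Q q_upb \<longrightarrow>
      1 \<le> t \<longrightarrow> (\<forall>\<tau> \<in> trace_nodes xs D Q. real (cost \<tau>) \<le> t) \<longrightarrow>
      uniformly_samples (map_spmf (outcome xs ds) (run prog xs ds q_upb cost)) (ans X D Q) \<and>
      expected_time (run prog xs ds q_upb cost)
        \<le> ennreal (C * max 1 (q_upb Map.empty / max 1 (real (card (ans X D Q)))
                               * real (card X) * real (card D)) * t)"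
proof (intro exI[of _ sampler] exI[of _ 100] allI impI)
  fix xs :: "'x list" and ds :: "'d list" and X D Q
    and q :: "('x, 'd) tuple \<Rightarrow> real" and cost :: "('x, 'd) tuple \<Rightarrow> nat" and t :: real
  assume xs: "distinct xs" and X: "set xs = X" and ds: "distinct ds" and D: "set ds = D"
    and Q: "join_query X D Q" and est: "estimator xs D Q q" and t: "1 \<le> t"
    and cost: "\<forall>\<tau> \<in> trace_nodes xs D Q. real (cost \<tau>) \<le> t"
  \<comment> \<open>Costs are natural numbers, so rounding \<open>t\<close> down keeps the cost
    bound.\<close>
  define T where "T = nat \<lfloor>t\<rfloor>"
  have T: "1 \<le> T" "real T \<le> t" using t by (simp_all add: T_def le_nat_floor)
  have "cost \<tau> \<le> T" if "\<tau> \<in> trace_nodes xs (set ds) Q" for \<tau>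
    using cost that by (auto simp: D T_def intro: le_nat_floor)
  then interpret W: word_estimator "length xs" "length ds" T "q \<circ> decode xs ds"
    "cost \<circ> decode xs ds" "consistent_word xs ds Q"
    using xs ds Q est by (intro word_estimator_decode) (auto simp: X D)
  have bij: "bij_betw (decode xs ds) W.answers (ans X D Q)"
    using bij_betw_decode[OF xs ds] Q by (simp add: X D W.answers_def)
  have card: "card (ans X D Q) = card W.answers"
    using bij_betw_same_card[OF bij] by simp
  have q0: "0 \<le> (q \<circ> decode xs ds) []"
    using est by (simp add: estimator_def trace_nodes_def)
  let ?p = "map_spmf (outcome xs ds) (run sampler xs ds q cost)"
  have "uniformly_samples ?p (ans X D Q)"
  proof (rule uniformly_samplesI)
    show "finite (ans X D Q)" using bij W.finite_answers bij_betw_finite by blast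
    show "ennreal 1 \<le> ennreal (spmf ?p Empty)" if "ans X D Q = {}"
    proof -
      have "W.answers = {}" using bij that by (simp add: bij_betw_def)
      from W.sampler_empty[OF q0 this] show ?thesis
        unfolding run_def ennreal_1
        by (rule order_trans) (rule wp_indicator_le_spmf, auto simp: outcome_def)
    qed
    show "ennreal (1 / real (card (ans X D Q))) \<le> ennreal (spmf ?p (Sample \<tau>))"
      if ans: "\<tau> \<in> ans X D Q" for \<tau>
    proof -
      obtain a where a: "a \<in> W.answers" "\<tau> = decode xs ds a"
        using ans unfolding bij_betw_imp_surj_on[OF bij, symmetric] by blast
      from W.sampler_answer[OF q0 a(1)] show ?thesis
        unfolding run_def card
        by (rule order_trans) (rule wp_indicator_le_spmf, auto simp: outcome_def a)
    qed
  qed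
  moreover have "expected_time (run sampler xs ds q cost)
      \<le> ennreal (100 * max 1 (q Map.empty / max 1 (real (card (ans X D Q)))
          * real (card X) * real (card D)) * t)"
  proof -
    have "card X = length xs" "card D = length ds"
      using xs ds X D distinct_card by auto
    then have "expected_time (run sampler xs ds q cost)
      \<le> ennreal (100 * max 1 (q Map.empty / max 1 (real (card (ans X D Q)))
          * real (card X) * real (card D)) * real T)"
      using W.sampler_time[OF q0 T(1)] by (simp add: expected_time_def run_def wp_def card)
    also have "\<dots> \<le> ennreal (100 * max 1 (q Map.empty / max 1 (real (card (ans X D Q)))
          * real (card X) * real (card D)) * t)"
      using T(2) by (intro ennreal_leI mult_left_mono) auto
    finally show ?thesis .
  qed
  ultimately show "uniformly_samples ?p (ans X D Q) \<and>
      expected_time (run sampler xs ds q cost)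
        \<le> ennreal (100 * max 1 (q Map.empty / max 1 (real (card (ans X D Q)))
             * real (card X) * real (card D)) * t)" by blast
qed

end
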